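(* Let $c_1,c_2\ge 1$ be integers such that either $c_2<c_1\leq 2c_2$ or $c_1=c_2>1$. Let $G\cong \mathbb{Z}^{(k)}\oplus \mathbb{Z}_{n_1}\oplus\cdots\oplus \mathbb{Z}_{n_t}$ be an infinite finitely generated abelian group, where $k,t\ge 0$, the $n_i$ are positive integers, and $n_{i+1}\mid n_i$ for $1\leq i \leq t-1$. Then $G$ is $[\mathfrak{N}_{c_1},\mathfrak{N}_{c_2}]$-capable if and only if $k\geq 2$.
   Context: $\mathbb{Z}_n$ is the cyclic group of order $n$ and $\mathbb{Z}^{(k)}$ is the direct sum of $k$ copies of $\mathbb{Z}$. For a set of words $V$ defining a variety $\mathfrak V$ and a group $E$, the marginal subgroup $V^*(E)$ is the set of all $a\in E$ such that $v(g_1,\dots,g_{i-1},g_ia,g_{i+1},\dots,g_n)=v(g_1,\dots,g_n)$ for all $v\in V$, all $g_1,\dots,g_n\in E$ and all $1\le i\le n$. A group $G$ is $\mathfrak V$-capable if there is a group $E$ with $G\cong E/V^*(E)$. $[\mathfrak{N}_{c_1},\mathfrak{N}_{c_2}]$ is the outer commutator variety defined by the single word $[[x_1,\dots,x_{c_1+1}],[y_1,\dots,y_{c_2+1}]]$ (left-normed commutators in distinct variables), i.e. the variety of groups $G$ with $[\gamma_{c_1+1}(G),\gamma_{c_2+1}(G)]=1$. *)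

theory Defs
  imports "HOL-Algebra.Algebra"
begin

text \<open>
  Group words in the variables \<open>x\<^sub>0, x\<^sub>1, \<dots>\<close>, as terms: every element of the free group on
  the variables is represented by some term, and only the values of a word in groups matter below.
\<close>

datatype word =
    Var nat
  | Unit
  | Inv word
  | Mult word word

primrec word_value :: "('a, 'b) monoid_scheme \<Rightarrow> (nat \<Rightarrow> 'a) \<Rightarrow> word \<Rightarrow> 'a" where
  "word_value E g (Var i) = g i"
| "word_value E g Unit = \<one>\<^bsub>E\<^esub>"
| "word_value E g (Inv v) = inv\<^bsub>E\<^esub> (word_value E g v)"
| "word_value E g (Mult v w) = word_value E g v \<otimes>\<^bsub>E\<^esub> word_value E g w"

text \<open>The convention is \<open>[v, w] = v\<inverse> w\<inverse> v w\<close>.\<close>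

definition comm_word :: "word \<Rightarrow> word \<Rightarrow> word" where
  "comm_word v w = Mult (Mult (Inv v) (Inv w)) (Mult v w)"

text \<open>\<open>[v\<^sub>1, \<dots>, v\<^sub>n] = [[\<dots>[v\<^sub>1, v\<^sub>2], \<dots>], v\<^sub>n]\<close>, with \<open>[v\<^sub>1] = v\<^sub>1\<close>.\<close>

fun left_normed_comm :: "word list \<Rightarrow> word" where
  "left_normed_comm [] = Unit"
| "left_normed_comm (v # vs) = foldl comm_word v vs"

text \<open>
  The word \<open>[[x\<^sub>1, \<dots>, x\<^bsub>c\<^sub>1+1\<^esub>], [y\<^sub>1, \<dots>, y\<^bsub>c\<^sub>2+1\<^esub>]]\<close>, where \<open>x\<^sub>i\<close> is variable number \<open>i\<close> and
  \<open>y\<^sub>j\<close> is variable number \<open>c\<^sub>1 + 1 + j\<close>.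
\<close>

definition nilp_comm_word :: "nat \<Rightarrow> nat \<Rightarrow> word" where
  "nilp_comm_word c1 c2 =
     comm_word (left_normed_comm (map Var [1..<c1 + 2]))
               (left_normed_comm (map (\<lambda>j. Var (c1 + 1 + j)) [1..<c2 + 2]))"

text \<open>
  An assignment gives values to all variables, including those not occurring in \<open>v\<close>; for the
  latter the condition below holds trivially.
\<close>

definition marginal_subgroup :: "word set \<Rightarrow> ('a, 'b) monoid_scheme \<Rightarrow> 'a set" where
  "marginal_subgroup V E =
     {a \<in> carrier E. \<forall>v \<in> V. \<forall>g. range g \<subseteq> carrier E \<longrightarrow>
        (\<forall>i. word_value E (g(i := g i \<otimes>\<^bsub>E\<^esub> a)) v = word_value E g v)}"

text \<open>
  \<open>variety_capable TYPE('e) V G\<close>: there is a group \<open>E\<close> with elements in the type \<open>'e\<close> such that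
  \<open>G \<cong> E / V\<^sup>*(E)\<close>. HOL cannot quantify over the type \<open>'e\<close> inside a formula, so it is a parameter.
  Nothing depends on its choice for an infinite finitely generated \<open>G\<close>, as long as \<open>'e\<close> is infinite
  (otherwise no \<open>E\<close> exists): if \<open>G \<cong> E / V\<^sup>*(E)\<close> and \<open>F\<close> is generated by finitely many
  elements whose cosets generate the quotient, then \<open>E = F V\<^sup>*(E)\<close>, hence \<open>V\<^sup>*(F) = F \<inter> V\<^sup>*(E)\<close> and
  \<open>F / V\<^sup>*(F) \<cong> G\<close>; and \<open>F\<close> is countable, so it has a copy in every infinite type.
\<close>

definition variety_capable :: "'e itself \<Rightarrow> word set \<Rightarrow> ('a, 'b) monoid_scheme \<Rightarrow> bool" where
  "variety_capable _ V G \<longleftrightarrow>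
     (\<exists>E :: 'e monoid. group E \<and> G \<cong> E Mod marginal_subgroup V E)"

text \<open>
  The direct sum \<open>\<int>\<^bsup>(k)\<^esup> \<oplus> \<int>\<^bsub>n\<^sub>1\<^esub> \<oplus> \<dots> \<oplus> \<int>\<^bsub>n\<^sub>t\<^esub>\<close>. Note that \<^term>\<open>integer_mod_group 0\<close> is infinite
  cyclic, so \<open>n\<^sub>i > 0\<close> has to be required.
\<close>

definition fg_abelian_sum :: "nat \<Rightarrow> nat \<Rightarrow> (nat \<Rightarrow> nat) \<Rightarrow> ((nat \<Rightarrow> int) \<times> (nat \<Rightarrow> int)) monoid" where
  "fg_abelian_sum k t n =
     sum_group {1..k} (\<lambda>_. integer_group) \<times>\<times> sum_group {1..t} (\<lambda>i. integer_mod_group (n i))"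

text \<open>The marginal subgroup is a normal subgroup, so the quotient above is a group.\<close>

context group begin

lemma word_value_closed:
  "range g \<subseteq> carrier G \<Longrightarrow> word_value G g v \<in> carrier G"
  by (induction v) auto

lemma word_value_conj:
  assumes "range g \<subseteq> carrier G" and h: "h \<in> carrier G"
  shows "word_value G (\<lambda>i. h \<otimes> g i \<otimes> inv h) v = h \<otimes> word_value G g v \<otimes> inv h"
proof (induction v)
  case (Mult v w)
  have c: "word_value G g v \<in> carrier G" "word_value G g w \<in> carrier G"
    using word_value_closed assms by blast+
  have "inv h \<otimes> (h \<otimes> (word_value G g w \<otimes> inv h)) = word_value G g w \<otimes> inv h"
    using c h by (simp add: inv_solve_left' m_assoc[symmetric])
  then show ?case using Mult c h by (simp add: m_assoc)
next
  case (Inv v)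
  have "word_value G g v \<in> carrier G"
    using word_value_closed assms by blast
  then show ?case using Inv h by (simp add: inv_mult_group m_assoc)
qed (use h in auto)

lemma marginal_subgroupD:
  "a \<in> marginal_subgroup V G \<Longrightarrow> v \<in> V \<Longrightarrow> range g \<subseteq> carrier G \<Longrightarrow>
     word_value G (g(i := g i \<otimes> a)) v = word_value G g v"
  unfolding marginal_subgroup_def by blast

lemma marginal_subgroup_normal: "marginal_subgroup V G \<lhd> G"
proof (rule normal_invI)
  show "subgroup (marginal_subgroup V G) G"
  proof (rule subgroupI)
    show "marginal_subgroup V G \<subseteq> carrier G" by (auto simp: marginal_subgroup_def)
    have "\<one> \<in> marginal_subgroup V G"
    proof -
      have "g(i := g i \<otimes> \<one>) = g" if "range g \<subseteq> carrier G" for g :: "nat \<Rightarrow> 'a" and i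
        using that by (auto simp: fun_eq_iff image_subset_iff)
      then show ?thesis unfolding marginal_subgroup_def by (simp del: fun_upd_apply)
    qed
    then show "marginal_subgroup V G \<noteq> {}" by blast
  next
    fix a assume a: "a \<in> marginal_subgroup V G"
    then have ac: "a \<in> carrier G" by (simp add: marginal_subgroup_def)
    have "word_value G (g(i := g i \<otimes> inv a)) v = word_value G g v"
      if v: "v \<in> V" and g: "range g \<subseteq> carrier G" for v g i
    proof -
      let ?g = "g(i := g i \<otimes> inv a)"
      have gc: "g j \<in> carrier G" for j using g by auto
      have "range ?g \<subseteq> carrier G" using gc ac by auto
      then have "word_value G (?g(i := ?g i \<otimes> a)) v = word_value G ?g v"
        by (rule marginal_subgroupD[OF a v])
      moreover have "?g(i := ?g i \<otimes> a) = g"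
        using gc ac by (auto simp: fun_eq_iff m_assoc)
      ultimately show ?thesis by simp
    qed
    then show "inv a \<in> marginal_subgroup V G" using ac by (simp add: marginal_subgroup_def)
  next
    fix a b assume a: "a \<in> marginal_subgroup V G" and b: "b \<in> marginal_subgroup V G"
    then have ac: "a \<in> carrier G" and bc: "b \<in> carrier G" by (simp_all add: marginal_subgroup_def)
    have "word_value G (g(i := g i \<otimes> (a \<otimes> b))) v = word_value G g v"
      if v: "v \<in> V" and g: "range g \<subseteq> carrier G" for v g i
    proof -
      let ?g = "g(i := g i \<otimes> a)"
      have gc: "g j \<in> carrier G" for j using g by auto
      have "range ?g \<subseteq> carrier G" using gc ac by auto
      then have "word_value G (?g(i := ?g i \<otimes> b)) v = word_value G ?g v"
        by (rule marginal_subgroupD[OF b v])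
      also have "\<dots> = word_value G g v" by (rule marginal_subgroupD[OF a v g])
      finally show ?thesis using gc ac bc by (simp add: m_assoc)
    qed
    then show "a \<otimes> b \<in> marginal_subgroup V G" using ac bc by (simp add: marginal_subgroup_def)
  qed
next
  fix h a assume h: "h \<in> carrier G" and a: "a \<in> marginal_subgroup V G"
  then have ac: "a \<in> carrier G" by (simp add: marginal_subgroup_def)
  have "word_value G (g(i := g i \<otimes> (h \<otimes> a \<otimes> inv h))) v = word_value G g v"
    if v: "v \<in> V" and g: "range g \<subseteq> carrier G" for v g i
  proof -
    let ?g = "\<lambda>j. inv h \<otimes> g j \<otimes> h"
    have gc: "g j \<in> carrier G" for j using g by auto
    have g': "range ?g \<subseteq> carrier G" using gc h by auto
    have unconj: "h \<otimes> (inv h \<otimes> x \<otimes> h) \<otimes> inv h = x" if "x \<in> carrier G" for x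
      using that h by (metis inv_closed inv_solve_right' m_assoc m_closed r_inv r_one l_one)
    have "word_value G g v = h \<otimes> word_value G ?g v \<otimes> inv h"
      using word_value_conj[OF g' h, of v] unconj gc by simp
    also have "word_value G ?g v = word_value G (?g(i := ?g i \<otimes> a)) v"
      by (rule marginal_subgroupD[OF a v g', symmetric])
    also have "h \<otimes> \<dots> \<otimes> inv h = word_value G (\<lambda>j. h \<otimes> (?g(i := ?g i \<otimes> a)) j \<otimes> inv h) v"
      using g' ac h by (intro word_value_conj[symmetric]) auto
    also have "(\<lambda>j. h \<otimes> (?g(i := ?g i \<otimes> a)) j \<otimes> inv h) = g(i := g i \<otimes> (h \<otimes> a \<otimes> inv h))"
    proof -
      have "h \<otimes> (inv h \<otimes> (g i \<otimes> (h \<otimes> (a \<otimes> inv h)))) = g i \<otimes> (h \<otimes> (a \<otimes> inv h))"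
        using gc h ac by (simp add: m_assoc[symmetric])
      then show ?thesis using unconj gc h ac by (auto simp: fun_eq_iff m_assoc)
    qed
    finally show ?thesis by (rule sym)
  qed
  then show "h \<otimes> a \<otimes> inv h \<in> marginal_subgroup V G"
    using h ac by (simp add: marginal_subgroup_def)
qed

end

end

theory Submission
  imports Defs "HOL-Library.Countable_Set"
begin

text \<open>
  If \<open>E / M\<close> is abelian for the marginal subgroup \<open>M\<close>, then all commutators are marginal, so the
  word induces a map on \<open>E / M\<close> that is multilinear and alternating in \<open>x\<^sub>1, x\<^sub>2\<close>. For
  \<open>E / M \<cong> \<int> \<oplus> T\<close> with \<open>m T = 0\<close>, this forces \<open>m\<close> times any value to vanish, so that the \<open>m\<close>-th
  power of a generator of \<open>\<int>\<close> is marginal, which is absurd.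

  Conversely, let \<open>H\<close> be the group of noncommutative integral power series with constant term \<open>1\<close>
  in one letter per cyclic summand, and \<open>N = c\<^sub>1 + c\<^sub>2 + 2\<close>. A value of the word is \<open>1\<close> plus the
  corresponding Lie polynomial in the linear parts of the arguments, up to terms of degree \<open>> N\<close>.
  Divide \<open>H\<close> by the series that are trivial below degree \<open>N\<close> and whose coefficient at each word of
  length \<open>N\<close> is divisible by the gcd of the orders of its letters, where infinite order counts as
  \<open>0\<close>. In the quotient, the marginal elements are those whose linear part vanishes in \<open>G\<close>:
  for a letter \<open>i\<close> and a second letter \<open>j\<close> of infinite order, some Lie polynomial in \<open>i, j\<close> has a
  coefficient \<open>\<plusminus>1\<close>, at a word whose modulus is the order of \<open>i\<close>.
\<close>

section \<open>Commutators modulo normal subgroups\<close>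

definition commutator :: "('a, 'b) monoid_scheme \<Rightarrow> 'a \<Rightarrow> 'a \<Rightarrow> 'a" where
  "commutator G x y = (inv\<^bsub>G\<^esub> x \<otimes>\<^bsub>G\<^esub> inv\<^bsub>G\<^esub> y) \<otimes>\<^bsub>G\<^esub> (x \<otimes>\<^bsub>G\<^esub> y)"

abbreviation iterated_commutator :: "('a, 'b) monoid_scheme \<Rightarrow> 'a \<Rightarrow> 'a list \<Rightarrow> 'a" where
  "iterated_commutator G \<equiv> foldl (commutator G)"

definition left_normed :: "('a, 'b) monoid_scheme \<Rightarrow> 'a list \<Rightarrow> 'a" where
  "left_normed G xs = iterated_commutator G (hd xs) (tl xs)"

lemma word_value_iterated_commutator:
  "word_value G g (foldl comm_word v vs) =
     iterated_commutator G (word_value G g v) (map (word_value G g) vs)"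
  by (induction vs arbitrary: v) (simp_all add: comm_word_def commutator_def)

lemma word_value_left_normed_comm:
  "vs \<noteq> [] \<Longrightarrow> word_value G g (left_normed_comm vs) = left_normed G (map (word_value G g) vs)"
  by (cases vs) (simp_all add: left_normed_def word_value_iterated_commutator)

lemma word_value_nilp_comm_word:
  "word_value G g (nilp_comm_word c1 c2) =
     commutator G (left_normed G (map g [1..<c1 + 2]))
       (left_normed G (map (\<lambda>j. g (c1 + 1 + j)) [1..<c2 + 2]))"
  by (simp add: nilp_comm_word_def comm_word_def word_value_left_normed_comm commutator_def
      comp_def del: upt_Suc)

lemma left_normed_append:
  "xs \<noteq> [] \<Longrightarrow> left_normed G (xs @ ys) = iterated_commutator G (left_normed G xs) ys"
  by (simp add: left_normed_def)

context group begin

section \<open>Commutator identities and the upper central series modulo a normal subgroup\<close>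

lemma inv_mult_cancel_left [simp]:
  "x \<in> carrier G \<Longrightarrow> y \<in> carrier G \<Longrightarrow> inv x \<otimes> (x \<otimes> y) = y"
  "x \<in> carrier G \<Longrightarrow> y \<in> carrier G \<Longrightarrow> x \<otimes> (inv x \<otimes> y) = y"
  by (simp_all add: m_assoc[symmetric])

lemma commutator_closed [simp]:
  "x \<in> carrier G \<Longrightarrow> y \<in> carrier G \<Longrightarrow> commutator G x y \<in> carrier G"
  by (simp add: commutator_def)

lemma iterated_commutator_closed [simp]:
  "x \<in> carrier G \<Longrightarrow> set ys \<subseteq> carrier G \<Longrightarrow> iterated_commutator G x ys \<in> carrier G"
  by (induction ys arbitrary: x) simp_all

lemma left_normed_closed:
  "xs \<noteq> [] \<Longrightarrow> set xs \<subseteq> carrier G \<Longrightarrow> left_normed G xs \<in> carrier G"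
  by (cases xs) (simp_all add: left_normed_def)

lemma commutator_mult_left:
  assumes "x \<in> carrier G" "y \<in> carrier G" "z \<in> carrier G"
  shows "commutator G (x \<otimes> y) z =
           commutator G x z \<otimes> commutator G (commutator G x z) y \<otimes> commutator G y z"
  using assms by (simp add: commutator_def m_assoc inv_mult_group)

lemma commutator_mult_right:
  assumes "x \<in> carrier G" "y \<in> carrier G" "z \<in> carrier G"
  shows "commutator G x (y \<otimes> z) =
           commutator G x z \<otimes> commutator G x y \<otimes> commutator G (commutator G x y) z"
  using assms by (simp add: commutator_def m_assoc inv_mult_group)

lemma inv_commutator:
  "x \<in> carrier G \<Longrightarrow> y \<in> carrier G \<Longrightarrow> inv (commutator G x y) = commutator G y x"
  by (simp add: commutator_def m_assoc inv_mult_group)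

lemma commutator_conj:
  assumes "x \<in> carrier G" "y \<in> carrier G" "h \<in> carrier G"
  shows "commutator G (h \<otimes> x \<otimes> inv h) (h \<otimes> y \<otimes> inv h) = h \<otimes> commutator G x y \<otimes> inv h"
  using assms by (simp add: commutator_def m_assoc inv_mult_group)

lemma commutator_eq_one_iff:
  assumes "x \<in> carrier G" "y \<in> carrier G"
  shows "commutator G x y = \<one> \<longleftrightarrow> x \<otimes> y = y \<otimes> x"
proof -
  have "commutator G x y = inv (y \<otimes> x) \<otimes> (x \<otimes> y)"
    using assms by (simp add: commutator_def inv_mult_group)
  then show ?thesis
    using assms by (metis inv_solve_left m_closed one_closed r_one)
qed

lemma iterated_commutator_one:
  "set ys \<subseteq> carrier G \<Longrightarrow> iterated_commutator G \<one> ys = \<one>"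
  by (induction ys) (simp_all add: commutator_def)

lemma iterated_commutator_conj:
  assumes "x \<in> carrier G" "set ys \<subseteq> carrier G" "h \<in> carrier G"
  shows "iterated_commutator G (h \<otimes> x \<otimes> inv h) (map (\<lambda>y. h \<otimes> y \<otimes> inv h) ys) =
           h \<otimes> iterated_commutator G x ys \<otimes> inv h"
  using assms by (induction ys arbitrary: x) (simp_all add: commutator_conj)

text \<open>For normal \<open>N\<close> this is the preimage of the centre of \<open>G / N\<close>.\<close>

definition central_mod :: "'a set \<Rightarrow> 'a set" where
  "central_mod N = {u \<in> carrier G. \<forall>x \<in> carrier G. commutator G u x \<in> N}"

lemma central_modD:
  "u \<in> central_mod N \<Longrightarrow> u \<in> carrier G"
  "u \<in> central_mod N \<Longrightarrow> x \<in> carrier G \<Longrightarrow> commutator G u x \<in> N"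
  by (simp_all add: central_mod_def)

lemma central_modI:
  "u \<in> carrier G \<Longrightarrow> (\<And>x. x \<in> carrier G \<Longrightarrow> commutator G u x \<in> N) \<Longrightarrow> u \<in> central_mod N"
  by (simp add: central_mod_def)

text \<open>Each closure property writes a commutator as a product of conjugates: [u^-1, x] = u
  [u, x]^-1 u^-1, [u v, x] = v^-1 [u, x] v [v, x] and [h u h^-1, x] = h [u, h^-1 x h] h^-1.
  Normality of \<open>N\<close> absorbs the conjugations.\<close>

lemma central_mod_normal:
  assumes "N \<lhd> G"
  shows "central_mod N \<lhd> G"
proof -
  interpret N: normal N G by fact
  have cl: "N \<subseteq> carrier G" by (rule N.subset)
  show ?thesis
  proof (rule normal_invI)
    show "subgroup (central_mod N) G"
    proof (rule subgroupI)
      show "central_mod N \<subseteq> carrier G" by (auto simp: central_mod_def)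
      have "\<one> \<in> central_mod N"
        using iterated_commutator_one[of "[_]"] by (simp add: central_mod_def)
      then show "central_mod N \<noteq> {}" by blast
    next
      fix u assume u: "u \<in> central_mod N"
      then have uc: "u \<in> carrier G" by (simp add: central_mod_def)
      have "commutator G (inv u) x \<in> N" if x: "x \<in> carrier G" for x
      proof -
        have "commutator G (inv u) x = u \<otimes> inv (commutator G u x) \<otimes> inv u"
          using uc x by (simp add: commutator_def m_assoc inv_mult_group)
        then show ?thesis
          using u x uc by (simp add: central_mod_def N.inv_op_closed2)
      qed
      then show "inv u \<in> central_mod N" using uc by (simp add: central_mod_def)
    next
      fix u v assume u: "u \<in> central_mod N" and v: "v \<in> central_mod N"
      then have uc: "u \<in> carrier G" and vc: "v \<in> carrier G" by (simp_all add: central_mod_def)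
      have "commutator G (u \<otimes> v) x \<in> N" if x: "x \<in> carrier G" for x
      proof -
        have "commutator G (u \<otimes> v) x = inv v \<otimes> commutator G u x \<otimes> v \<otimes> commutator G v x"
          using uc vc x by (simp add: commutator_def m_assoc inv_mult_group)
        then show ?thesis
          using u v x vc by (simp add: central_mod_def N.inv_op_closed1)
      qed
      then show "u \<otimes> v \<in> central_mod N" using uc vc by (simp add: central_mod_def)
    qed
  next
    fix h u assume h: "h \<in> carrier G" and u: "u \<in> central_mod N"
    then have uc: "u \<in> carrier G" by (simp add: central_mod_def)
    have "commutator G (h \<otimes> u \<otimes> inv h) x \<in> N" if x: "x \<in> carrier G" for x
    proof -
      have "commutator G (h \<otimes> u \<otimes> inv h) x = h \<otimes> commutator G u (inv h \<otimes> x \<otimes> h) \<otimes> inv h"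
        using uc h x by (simp add: commutator_def m_assoc inv_mult_group)
      then show ?thesis
        using u x h by (simp add: central_mod_def N.inv_op_closed2)
    qed
    then show "h \<otimes> u \<otimes> inv h \<in> central_mod N" using uc h by (simp add: central_mod_def)
  qed
qed

lemma central_mod_iter_normal: "N \<lhd> G \<Longrightarrow> (central_mod ^^ r) N \<lhd> G"
  by (induction r) (simp_all add: central_mod_normal)

text \<open>The iterates of \<open>central_mod\<close> are the upper central series modulo
  \<open>N\<close>; write Z_r for the r-th one. Membership is recognized here by bracketing r
  times.\<close>

lemma in_central_mod_iter:
  assumes "u \<in> carrier G"
    and "\<And>zs. set zs \<subseteq> carrier G \<Longrightarrow> length zs = r \<Longrightarrow> iterated_commutator G u zs \<in> N"
  shows "u \<in> (central_mod ^^ r) N"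
  using assms
proof (induction r arbitrary: u)
  case 0
  then show ?case using "0.prems"(2)[of "[]"] by simp
next
  case (Suc r)
  have "commutator G u z \<in> (central_mod ^^ r) N" if "z \<in> carrier G" for z
    using Suc.prems(2)[of "z # _"] that Suc.prems(1) by (intro Suc.IH) auto
  then show ?case using Suc.prems(1) by (simp add: central_modI)
qed

lemma iterated_commutator_in_central_mod_iter:
  assumes "u \<in> (central_mod ^^ (length zs + r)) N" "set zs \<subseteq> carrier G"
  shows "iterated_commutator G u zs \<in> (central_mod ^^ r) N"
  using assms by (induction zs arbitrary: u) (simp_all add: central_modD)

lemma commutator_in_normal:
  assumes "N \<lhd> G" "d \<in> central_mod N" "x \<in> carrier G"
  shows "commutator G x d \<in> N"
proof -
  interpret N: normal N G by fact
  have d: "d \<in> carrier G" "commutator G d x \<in> N" using assms by (simp_all add: central_mod_def)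
  then show ?thesis using inv_commutator[OF d(1) assms(3)] by (metis N.m_inv_closed)
qed

text \<open>Expanding [u v d, z] leaves three corrections. [[u, z], v] lies in \<open>N\<close>
  because [u, z] is central modulo \<open>N\<close>; [[u v, z], d] and [d, z] lie in
  \<open>N\<close> because \<open>d\<close> is. Allowing the factor \<open>d\<close> in the input
  makes the statement fit for iteration.\<close>

lemma commutator_mult_mod:
  assumes N: "N \<lhd> G" and z: "z \<in> carrier G" and d: "d \<in> central_mod N"
    and u: "u \<in> central_mod (central_mod N)" and v: "v \<in> central_mod (central_mod N)"
  obtains d' where "d' \<in> N" "commutator G (u \<otimes> v \<otimes> d) z = commutator G u z \<otimes> commutator G v z \<otimes> d'"
proof -
  interpret N: normal N G by fact
  have c: "u \<in> carrier G" "v \<in> carrier G" "d \<in> carrier G"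
    using u v d by (simp_all add: central_mod_def)
  define x y n1 where "x = commutator G u z" and "y = commutator G v z"
    and "n1 = commutator G x v"
  have xc: "x \<in> carrier G" and yc: "y \<in> carrier G"
    using c z by (simp_all add: x_def y_def)
  have "x \<in> central_mod N" using u z by (simp add: central_mod_def x_def)
  then have n1: "n1 \<in> N" using c by (simp add: central_mod_def n1_def)
  have n1c: "n1 \<in> carrier G" using n1 N.subset by blast
  define n2 where "n2 = commutator G (commutator G (u \<otimes> v) z) d"
  have n2: "n2 \<in> N" unfolding n2_def using c z d by (intro commutator_in_normal[OF N]) auto
  have n3: "commutator G d z \<in> N" using d z by (simp add: central_mod_def)
  have cc: "n2 \<in> carrier G" "commutator G d z \<in> carrier G"
    using n2 N.subset c z by auto
  have "commutator G (u \<otimes> v \<otimes> d) z = commutator G (u \<otimes> v) z \<otimes> n2 \<otimes> commutator G d z"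
    unfolding n2_def using c z by (intro commutator_mult_left) auto
  also have "commutator G (u \<otimes> v) z = x \<otimes> n1 \<otimes> y"
    unfolding x_def y_def n1_def using c z by (intro commutator_mult_left) auto
  also have "\<dots> \<otimes> n2 \<otimes> commutator G d z = x \<otimes> y \<otimes> ((inv y \<otimes> n1 \<otimes> y) \<otimes> n2 \<otimes> commutator G d z)"
    using xc yc n1c cc by (simp add: m_assoc)
  finally show thesis
    using n1 n2 n3 yc by (intro that[of "(inv y \<otimes> n1 \<otimes> y) \<otimes> n2 \<otimes> commutator G d z"])
      (auto simp: x_def y_def N.inv_op_closed1)
qed

text \<open>Each further bracketing descends one level in the upper central series, and the error of
  one step is the \<open>d\<close> of the next, until it lands in Z_0 = \<open>N\<close>.\<close>

lemma iterated_commutator_mult_mod: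
  assumes "N \<lhd> G" and "set zs \<subseteq> carrier G" and "length zs = s"
    and "u \<in> (central_mod ^^ Suc s) N" "v \<in> (central_mod ^^ Suc s) N" "d \<in> (central_mod ^^ s) N"
  shows "\<exists>d' \<in> N. iterated_commutator G (u \<otimes> v \<otimes> d) zs =
           iterated_commutator G u zs \<otimes> iterated_commutator G v zs \<otimes> d'"
  using assms(2-)
proof (induction zs arbitrary: u v d s)
  case Nil
  then show ?case by auto
next
  case (Cons z zs)
  define s' where "s' = length zs"
  have s: "s = Suc s'" using Cons.prems by (simp add: s'_def)
  have z: "z \<in> carrier G" using Cons.prems by simp
  obtain d' where d': "d' \<in> (central_mod ^^ s') N"
    "commutator G (u \<otimes> v \<otimes> d) z = commutator G u z \<otimes> commutator G v z \<otimes> d'"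
    using commutator_mult_mod[OF central_mod_iter_normal[OF assms(1)] z, of d s' u v] Cons.prems
    by (auto simp: s)
  have "commutator G u z \<in> (central_mod ^^ Suc s') N" "commutator G v z \<in> (central_mod ^^ Suc s') N"
    using Cons.prems z by (auto simp: s dest: central_modD)
  from Cons.IH[OF _ _ this d'(1)] show ?case
    using Cons.prems d'(2) by (simp add: s'_def)
qed

text \<open>By \<open>all\<close> the quotient by \<open>N\<close> is nilpotent of class at most c +
  1, so commutators of weight c + 1 are central there and hence multiplicative in each
  entry.\<close>

lemma left_normed_mult_mod:
  assumes N: "N \<lhd> G" and all: "carrier G \<subseteq> (central_mod ^^ Suc c) N"
    and l: "length ps + length qs = c"
    and ps: "set ps \<subseteq> carrier G" and qs: "set qs \<subseteq> carrier G"
    and x: "x \<in> carrier G" and y: "y \<in> carrier G"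
  shows "\<exists>d \<in> N. left_normed G (ps @ (x \<otimes> y) # qs) =
           left_normed G (ps @ x # qs) \<otimes> left_normed G (ps @ y # qs) \<otimes> d"
proof (cases "ps = []")
  case True
  have "\<one> \<in> (central_mod ^^ c) N"
    using central_mod_iter_normal[OF N] by (metis normal_def subgroup.one_closed)
  then show ?thesis
    using iterated_commutator_mult_mod[OF N qs, of c x y \<one>] True l all x y
    by (auto simp: left_normed_def)
next
  case False
  define p s where "p = left_normed G ps" and "s = length qs"
  obtain r rs where rs: "ps = r # rs" using False by (cases ps) auto
  have pc: "p \<in> carrier G" unfolding p_def using False ps by (rule left_normed_closed)
  \<comment> \<open>Forming \<open>p\<close> uses c - s - 1 of the c + 1 available levels, which
    puts \<open>p\<close> in Z_(s+2). Then [p, x] and [p, y] are in Z_(s+1), and the correction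
    \<open>d\<close> below is in Z_s.\<close>
  have "Suc c = length rs + Suc (Suc s)" using l rs by (simp add: s_def)
  then have p: "p \<in> (central_mod ^^ Suc (Suc s)) N"
    using iterated_commutator_in_central_mod_iter[of r rs "Suc (Suc s)" N] all ps
    unfolding p_def rs left_normed_def by auto
  have e: "left_normed G (ps @ z # qs) = iterated_commutator G (commutator G p z) qs" for z
    using False by (simp add: left_normed_append p_def)
  interpret S: normal "(central_mod ^^ s) N" G by (rule central_mod_iter_normal[OF N])
  have u: "commutator G p z \<in> (central_mod ^^ Suc s) N" if "z \<in> carrier G" for z
    using p that by (auto dest: central_modD)
  define u v where "u = commutator G p x" and "v = commutator G p y"
  have uc: "u \<in> carrier G" and vc: "v \<in> carrier G" using pc x y by (simp_all add: u_def v_def)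
  \<comment> \<open>The expansion of [p, x y] produces the factors in the order v u; [v, u] restores
    the order u v and joins the other correction.\<close>
  define d where "d = commutator G v u \<otimes> commutator G u y"
  have d: "d \<in> (central_mod ^^ s) N"
    unfolding d_def using u[OF x] u[OF y] uc vc y
    by (intro S.m_closed) (auto simp: u_def v_def dest: central_modD)
  have "commutator G p (x \<otimes> y) = v \<otimes> u \<otimes> commutator G u y"
    unfolding u_def v_def using pc x y by (rule commutator_mult_right)
  also have "\<dots> = u \<otimes> v \<otimes> d"
    using uc vc y by (simp add: d_def commutator_def m_assoc inv_mult_group)
  finally have "commutator G p (x \<otimes> y) = u \<otimes> v \<otimes> d" .
  then show ?thesis
    using iterated_commutator_mult_mod[OF N qs s_def[symmetric] u[OF x] u[OF y] d]
    by (simp add: e u_def v_def)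
qed

end

section \<open>Multilinearity\<close>

lemma assignment_exists:
  assumes "length xs = Suc c1" "length ys = Suc c2" "set xs \<subseteq> A" "set ys \<subseteq> A"
  obtains g :: "nat \<Rightarrow> 'a" where "range g \<subseteq> A"
    "map g [1..<c1 + 2] = xs" "map (\<lambda>j. g (c1 + 1 + j)) [1..<c2 + 2] = ys"
proof
  \<comment> \<open>The default \<open>hd xs\<close> keeps all remaining variables, variable 0 among
    them, inside \<open>A\<close>.\<close>
  define g where "g i = (if 1 \<le> i \<and> i \<le> Suc c1 then xs ! (i - 1)
    else if c1 + 2 \<le> i \<and> i < c1 + 2 + Suc c2 then ys ! (i - c1 - 2) else hd xs)" for i
  have "hd xs \<in> A" using assms by (cases xs) auto
  moreover have "xs ! j \<in> A" if "j \<le> c1" for j using assms that nth_mem[of j xs] by auto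
  moreover have "ys ! j \<in> A" if "j \<le> c2" for j using assms that nth_mem[of j ys] by auto
  ultimately show "range g \<subseteq> A" by (auto simp: g_def)
  show "map g [1..<c1 + 2] = xs" "map (\<lambda>j. g (c1 + 1 + j)) [1..<c2 + 2] = ys"
    using assms by (auto intro!: nth_equalityI simp: g_def simp del: upt_Suc)
qed

lemma map_upt_fun_upd:
  fixes i :: nat
  assumes "1 \<le> i" "i < m"
  shows "map (g(i := x)) [1..<m] = map g [1..<i] @ x # map g [Suc i..<m]"
proof -
  have "[1..<m] = [1..<i] @ i # [Suc i..<m]"
    using assms upt_add_eq_append[of 1 i "m - i"] by (simp add: upt_conv_Cons)
  then show ?thesis by simp
qed

section \<open>Left-normed commutator values, their centralizers, and multilinearity of the
  word\<close>

context group begin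

text \<open>The index is one less than the weight, in accordance with \<open>c1\<close> and
  \<open>c2\<close>: the set is trivial exactly if the group is nilpotent of class at most
  c.\<close>

definition left_normed_set :: "nat \<Rightarrow> 'a set" where
  "left_normed_set c = {left_normed G xs | xs. length xs = Suc c \<and> set xs \<subseteq> carrier G}"

lemma left_normed_setI:
  "length xs = Suc c \<Longrightarrow> set xs \<subseteq> carrier G \<Longrightarrow> left_normed G xs \<in> left_normed_set c"
  by (auto simp: left_normed_set_def)

lemma left_normed_setE:
  assumes "s \<in> left_normed_set c"
  obtains xs where "s = left_normed G xs" "length xs = Suc c" "set xs \<subseteq> carrier G"
  using assms by (auto simp: left_normed_set_def)

lemma left_normed_set_closed: "s \<in> left_normed_set c \<Longrightarrow> s \<in> carrier G"
  unfolding left_normed_set_def by (auto intro!: left_normed_closed)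

lemma left_normed_set_conj:
  assumes "s \<in> left_normed_set c" and h: "h \<in> carrier G"
  shows "h \<otimes> s \<otimes> inv h \<in> left_normed_set c"
proof -
  obtain xs where xs: "s = left_normed G xs" "length xs = Suc c" "set xs \<subseteq> carrier G"
    using assms(1) by (auto simp: left_normed_set_def)
  obtain x zs where "xs = x # zs" using xs(2) by (cases xs) auto
  then have s: "s = iterated_commutator G x zs" and "x \<in> carrier G" "length zs = c"
    "set zs \<subseteq> carrier G"
    using xs by (auto simp: left_normed_def)
  then have "h \<otimes> s \<otimes> inv h = left_normed G ((h \<otimes> x \<otimes> inv h) # map (\<lambda>y. h \<otimes> y \<otimes> inv h) zs)"
    using h by (simp add: left_normed_def iterated_commutator_conj)
  also have "\<dots> \<in> left_normed_set c"
    using h \<open>x \<in> _\<close> \<open>length zs = c\<close> \<open>set zs \<subseteq> _\<close> by (intro left_normed_setI) auto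
  finally show ?thesis .
qed

text \<open>The first c1 - c2 + 1 entries are merged into a single one, itself a left-normed
  commutator.\<close>

lemma left_normed_set_antimono:
  assumes "c2 \<le> c1"
  shows "left_normed_set c1 \<subseteq> left_normed_set c2"
proof
  fix s assume "s \<in> left_normed_set c1"
  then obtain xs where xs: "s = left_normed G xs" "length xs = Suc c1" "set xs \<subseteq> carrier G"
    by (auto simp: left_normed_set_def)
  define as bs where "as = take (Suc (c1 - c2)) xs" and "bs = drop (Suc (c1 - c2)) xs"
  have e: "xs = as @ bs" by (simp add: as_def bs_def)
  have ne: "as \<noteq> []" using xs(2) by (auto simp: as_def)
  have len: "length bs = c2" using xs(2) assms by (simp add: bs_def)
  have sub: "set as \<subseteq> carrier G" "set bs \<subseteq> carrier G" using xs(3) unfolding e by auto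
  have "s = left_normed G (left_normed G as # bs)"
    using ne unfolding xs e by (simp add: left_normed_append) (simp add: left_normed_def)
  also have "\<dots> \<in> left_normed_set c2"
    using assms ne left_normed_closed[of as] len sub by (intro left_normed_setI) auto
  finally show "s \<in> left_normed_set c2" .
qed

lemma commutator_in_left_normed_set:
  assumes "s \<in> left_normed_set c" "x \<in> carrier G"
  shows "commutator G s x \<in> left_normed_set (Suc c)"
proof -
  obtain xs where xs: "s = left_normed G xs" "length xs = Suc c" "set xs \<subseteq> carrier G"
    using assms by (auto simp: left_normed_set_def)
  then have "commutator G s x = left_normed G (xs @ [x])"
    by (subst left_normed_append) auto
  then show ?thesis using xs assms(2) by (auto intro!: left_normed_setI)
qed

definition centralizer :: "'a set \<Rightarrow> 'a set" where
  "centralizer S = {d \<in> carrier G. \<forall>s \<in> S. d \<otimes> s = s \<otimes> d}"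

lemma commute_inv:
  assumes "d \<in> carrier G" "s \<in> carrier G" "d \<otimes> s = s \<otimes> d"
  shows "inv d \<otimes> s = s \<otimes> inv d"
proof -
  have "inv d \<otimes> s = inv d \<otimes> (s \<otimes> d) \<otimes> inv d" using assms(1,2) by (simp add: m_assoc)
  also have "\<dots> = s \<otimes> inv d" unfolding assms(3)[symmetric] using assms(1,2) by (simp add: m_assoc)
  finally show ?thesis .
qed

lemma centralizer_normal:
  assumes S: "S \<subseteq> carrier G"
    and conj: "\<And>s h. s \<in> S \<Longrightarrow> h \<in> carrier G \<Longrightarrow> h \<otimes> s \<otimes> inv h \<in> S"
  shows "centralizer S \<lhd> G"
proof (rule normal_invI)
  show "subgroup (centralizer S) G"
  proof (rule subgroupI)
    show "centralizer S \<subseteq> carrier G" by (auto simp: centralizer_def)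
    have "\<one> \<in> centralizer S" using S by (auto simp: centralizer_def)
    then show "centralizer S \<noteq> {}" by blast
  next
    fix a assume "a \<in> centralizer S"
    then show "inv a \<in> centralizer S"
      using S by (auto simp: centralizer_def intro!: commute_inv)
  next
    fix a b assume a: "a \<in> centralizer S" and b: "b \<in> centralizer S"
    have "a \<otimes> b \<otimes> s = s \<otimes> (a \<otimes> b)" if "s \<in> S" for s
    proof -
      have c: "a \<in> carrier G" "b \<in> carrier G" "s \<in> carrier G" "a \<otimes> s = s \<otimes> a" "b \<otimes> s = s \<otimes> b"
        using a b that S by (auto simp: centralizer_def)
      then show ?thesis by (metis m_assoc)
    qed
    then show "a \<otimes> b \<in> centralizer S" using a b by (auto simp: centralizer_def)
  qed
next
  fix h d assume h: "h \<in> carrier G" and d: "d \<in> centralizer S"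
  then have dc: "d \<in> carrier G" by (simp add: centralizer_def)
  have "h \<otimes> d \<otimes> inv h \<otimes> s = s \<otimes> (h \<otimes> d \<otimes> inv h)" if s: "s \<in> S" for s
  proof -
    have sc: "s \<in> carrier G" using s S by blast
    have "inv h \<otimes> s \<otimes> h \<in> S" using conj[OF s, of "inv h"] h by simp
    then have e: "d \<otimes> (inv h \<otimes> s \<otimes> h) = (inv h \<otimes> s \<otimes> h) \<otimes> d" using d by (simp add: centralizer_def)
    have "h \<otimes> d \<otimes> inv h \<otimes> s = h \<otimes> (d \<otimes> (inv h \<otimes> s \<otimes> h)) \<otimes> inv h"
      using h dc sc by (simp add: m_assoc)
    also have "\<dots> = s \<otimes> (h \<otimes> d \<otimes> inv h)"
      unfolding e using h dc sc by (simp add: m_assoc)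
    finally show ?thesis .
  qed
  then show "h \<otimes> d \<otimes> inv h \<in> centralizer S" using h dc by (simp add: centralizer_def)
qed

text \<open>By \<open>comm\<close> the group is nilpotent modulo the centralizer \<open>D\<close> of
  the commutators of weight c2 + 1. So the left-normed commutator is multiplicative up to a factor
  in \<open>D\<close>, which disappears in the commutator with \<open>B\<close>. In [P Q, B] =
  [P, B] [[P, B], Q] [Q, B] the middle term vanishes by \<open>comm'\<close>.\<close>

lemma commutator_left_normed_mult:
  assumes comm: "\<And>A B. A \<in> left_normed_set (Suc c1) \<Longrightarrow> B \<in> left_normed_set c2 \<Longrightarrow> A \<otimes> B = B \<otimes> A"
    and comm': "\<And>A A' B. A \<in> left_normed_set c1 \<Longrightarrow> A' \<in> left_normed_set c1 \<Longrightarrow>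
      B \<in> left_normed_set c2 \<Longrightarrow> commutator G A B \<otimes> A' = A' \<otimes> commutator G A B"
    and l: "length ps + length qs = c1"
    and ps: "set ps \<subseteq> carrier G" and qs: "set qs \<subseteq> carrier G"
    and x: "x \<in> carrier G" and y: "y \<in> carrier G"
    and B: "B \<in> left_normed_set c2"
  shows "commutator G (left_normed G (ps @ (x \<otimes> y) # qs)) B =
    commutator G (left_normed G (ps @ x # qs)) B \<otimes> commutator G (left_normed G (ps @ y # qs)) B"
proof -
  define D where "D = centralizer (left_normed_set c2)"
  have D: "D \<lhd> G" unfolding D_def
    by (rule centralizer_normal) (auto intro: left_normed_set_closed left_normed_set_conj)
  interpret D: normal D G by fact
  have "u \<in> (central_mod ^^ Suc c1) D" if u: "u \<in> carrier G" for u
  proof (rule in_central_mod_iter[OF u])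
    fix zs assume zs: "set zs \<subseteq> carrier G" "length zs = Suc c1"
    then have "left_normed G (u # zs) \<in> left_normed_set (Suc c1)"
      using u by (intro left_normed_setI) auto
    moreover have "left_normed G (u # zs) = iterated_commutator G u zs"
      by (simp add: left_normed_def)
    ultimately have "iterated_commutator G u zs \<in> left_normed_set (Suc c1)" by simp
    then show "iterated_commutator G u zs \<in> D"
      unfolding D_def centralizer_def by (blast intro: comm left_normed_set_closed)
  qed
  then have "carrier G \<subseteq> (central_mod ^^ Suc c1) D" by blast
  from left_normed_mult_mod[OF D this l ps qs x y] obtain d where d: "d \<in> D" and
    e: "left_normed G (ps @ (x \<otimes> y) # qs) =
      left_normed G (ps @ x # qs) \<otimes> left_normed G (ps @ y # qs) \<otimes> d" by blast
  define P Q where "P = left_normed G (ps @ x # qs)" and "Q = left_normed G (ps @ y # qs)"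
  have PQ: "P \<in> left_normed_set c1" "Q \<in> left_normed_set c1"
    using l ps qs x y by (auto simp: P_def Q_def intro!: left_normed_setI)
  then have c: "P \<in> carrier G" "Q \<in> carrier G" "B \<in> carrier G" "d \<in> carrier G"
    using B d D.subset left_normed_set_closed by auto
  \<comment> \<open>Conjugation moves the error to the front, where [d', B] = 1 removes both terms
    that contain it; normality of \<open>D\<close> keeps the conjugate in \<open>D\<close>.\<close>
  define d' where "d' = (P \<otimes> Q) \<otimes> d \<otimes> inv (P \<otimes> Q)"
  have d': "d' \<in> D" unfolding d'_def using c d by (intro D.inv_op_closed2) auto
  have d'c: "d' \<in> carrier G" using d' D.subset by blast
  have "d' \<otimes> B = B \<otimes> d'" using d' B unfolding D_def centralizer_def by blast
  then have one: "commutator G d' B = \<one>" using c d'c by (simp only: commutator_eq_one_iff)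
  have "P \<otimes> Q \<otimes> d = d' \<otimes> (P \<otimes> Q)"
    using c by (simp add: d'_def m_assoc inv_mult_group)
  then have "commutator G (P \<otimes> Q \<otimes> d) B = commutator G (d' \<otimes> (P \<otimes> Q)) B" by simp
  also have "\<dots> = commutator G d' B \<otimes> commutator G (commutator G d' B) (P \<otimes> Q) \<otimes> commutator G (P \<otimes> Q) B"
    using c d'c by (intro commutator_mult_left) auto
  also have "\<dots> = commutator G (P \<otimes> Q) B"
    using c iterated_commutator_one[of "[_]"] by (simp add: one)
  also have "\<dots> = commutator G P B \<otimes> commutator G (commutator G P B) Q \<otimes> commutator G Q B"
    using c by (intro commutator_mult_left) auto
  also have "commutator G (commutator G P B) Q = \<one>"
    using comm'[OF PQ B] c by (simp add: commutator_eq_one_iff)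
  finally show ?thesis using c by (simp add: e P_def Q_def)
qed

text \<open>Marginality of commutators forces those of weight c1 + 2 to commute with those of weight
  c2 + 1, and the same with \<open>c1\<close> and \<open>c2\<close> exchanged. This supplies the
  hypotheses of \<open>commutator_left_normed_mult\<close> for either bracket.\<close>

lemma nilp_word_hom:
  assumes V: "\<And>x y. x \<in> carrier G \<Longrightarrow> y \<in> carrier G \<Longrightarrow>
      commutator G x y \<in> marginal_subgroup {nilp_comm_word c1 c2} G"
    and c: "c2 \<le> c1"
    and g: "range g \<subseteq> carrier G" and i: "1 \<le> i" "i \<le> c1 + c2 + 2"
  shows "(\<lambda>x. word_value G (g(i := x)) (nilp_comm_word c1 c2)) \<in> hom G G"
proof -
  let ?w = "nilp_comm_word c1 c2"
  \<comment> \<open>Any two lists of entries come from an assignment. Variables 1 and c1 + 2 are x_1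
    and y_1, the innermost entries of the two brackets.\<close>
  have val: "\<exists>g. range g \<subseteq> carrier G \<and> g 1 = hd xs \<and> g (c1 + 2) = hd ys \<and>
      (\<forall>z. word_value G (g(1 := z)) ?w = commutator G (left_normed G (z # tl xs)) (left_normed G ys)) \<and>
      (\<forall>z. word_value G (g(c1 + 2 := z)) ?w = commutator G (left_normed G xs) (left_normed G (z # tl ys)))"
    if l: "length xs = Suc c1" "length ys = Suc c2" "set xs \<subseteq> carrier G" "set ys \<subseteq> carrier G" for xs ys
  proof -
    obtain g where g: "range g \<subseteq> carrier G" "map g [1..<c1 + 2] = xs"
      "map (\<lambda>j. g (c1 + 1 + j)) [1..<c2 + 2] = ys"
      using assignment_exists[OF l] .
    have "xs = g 1 # map g [2..<c1 + 2]"
      using g(2) upt_conv_Cons[of 1 "c1 + 2"] by (simp add: numeral_2_eq_2 del: upt_Suc)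
    moreover have "ys = g (c1 + 2) # map (\<lambda>j. g (c1 + 1 + j)) [2..<c2 + 2]"
      using g(3) upt_conv_Cons[of 1 "c2 + 2"] by (simp add: numeral_2_eq_2 del: upt_Suc)
    moreover have "map (g(1 := z)) [1..<c1 + 2] = z # map g [2..<c1 + 2]" for z
      by (subst map_upt_fun_upd) (simp_all add: numeral_2_eq_2 del: upt_Suc)
    moreover have "map (\<lambda>j. (g(c1 + 2 := z)) (c1 + 1 + j)) [1..<c2 + 2]
       = z # map (\<lambda>j. g (c1 + 1 + j)) [2..<c2 + 2]" for z
      using upt_conv_Cons[of 1 "c2 + 2"] by (simp add: numeral_2_eq_2 del: upt_Suc)
    moreover have "map (g(c1 + 2 := z)) [1..<c1 + 2] = xs" for z
      unfolding g(2)[symmetric] by auto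
    moreover have "map (\<lambda>j. (g(1 := z)) (c1 + 1 + j)) [1..<c2 + 2] = ys" for z
      unfolding g(3)[symmetric] by (auto simp del: upt_Suc)
    ultimately show ?thesis
      using g(1) by (intro exI[of _ g]) (simp add: word_value_nilp_comm_word del: upt_Suc fun_upd_apply)
  qed
  \<comment> \<open>A commutator of weight c1 + 2 is one of weight c1 + 1 with first entry [a, b].
    Shifting x_1 = 1 by the marginal element [a, b] does not change the value, which is trivial at
    x_1 = 1.\<close>
  have comm12: "A \<otimes> B = B \<otimes> A" if AB: "A \<in> left_normed_set (Suc c1)" "B \<in> left_normed_set c2" for A B
  proof -
    obtain xs where xs: "A = left_normed G xs" "length xs = Suc (Suc c1)" "set xs \<subseteq> carrier G"
      using AB(1) by (rule left_normed_setE)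
    obtain a b zs where ab: "xs = a # b # zs" using xs(2) by (metis length_Suc_conv)
    obtain ys where ys: "B = left_normed G ys" "length ys = Suc c2" "set ys \<subseteq> carrier G"
      using AB(2) by (rule left_normed_setE)
    have abc: "a \<in> carrier G" "b \<in> carrier G" "set zs \<subseteq> carrier G" "length zs = c1"
      using xs ab by auto
    obtain g where g: "range g \<subseteq> carrier G" "g 1 = \<one>"
      "\<And>z. word_value G (g(1 := z)) ?w = commutator G (left_normed G (z # zs)) B"
      using val[of "\<one> # zs" ys] abc ys by auto
    have "commutator G (left_normed G (commutator G a b # zs)) B = word_value G (g(1 := g 1 \<otimes> commutator G a b)) ?w"
      using abc by (simp only: g l_one commutator_closed)
    also have "\<dots> = word_value G (g(1 := g 1)) ?w"
      using marginal_subgroupD[OF V[OF abc(1,2)] _ g(1)] by simp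
    also have "\<dots> = commutator G \<one> B"
      unfolding g using abc by (simp add: left_normed_def iterated_commutator_one)
    also have "\<dots> = \<one>"
      using AB(2) left_normed_set_closed iterated_commutator_one[of "[_]"] by simp
    finally have "commutator G A B = \<one>" by (simp add: xs ab left_normed_def)
    then show ?thesis using AB left_normed_set_closed by (simp add: commutator_eq_one_iff)
  qed
  have comm21: "B \<otimes> A = A \<otimes> B" if BA: "B \<in> left_normed_set (Suc c2)" "A \<in> left_normed_set c1" for A B
  proof -
    obtain ys where ys: "B = left_normed G ys" "length ys = Suc (Suc c2)" "set ys \<subseteq> carrier G"
      using BA(1) by (rule left_normed_setE)
    obtain a b zs where ab: "ys = a # b # zs" using ys(2) by (metis length_Suc_conv)
    obtain xs where xs: "A = left_normed G xs" "length xs = Suc c1" "set xs \<subseteq> carrier G"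
      using BA(2) by (rule left_normed_setE)
    have abc: "a \<in> carrier G" "b \<in> carrier G" "set zs \<subseteq> carrier G" "length zs = c2"
      using ys ab by auto
    obtain g where g: "range g \<subseteq> carrier G" "g (c1 + 2) = \<one>"
      "\<And>z. word_value G (g(c1 + 2 := z)) ?w = commutator G A (left_normed G (z # zs))"
      using val[of xs "\<one> # zs"] abc xs by auto
    have "commutator G A (left_normed G (commutator G a b # zs)) =
        word_value G (g(c1 + 2 := g (c1 + 2) \<otimes> commutator G a b)) ?w"
      using abc by (simp only: g l_one commutator_closed)
    also have "\<dots> = word_value G (g(c1 + 2 := g (c1 + 2))) ?w"
      using marginal_subgroupD[OF V[OF abc(1,2)] _ g(1)] by simp
    also have "\<dots> = commutator G A \<one>"
      unfolding g using abc by (simp add: left_normed_def iterated_commutator_one)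
    also have "\<dots> = \<one>"
      using BA(2) left_normed_set_closed by (simp add: commutator_def)
    finally have "commutator G A B = \<one>" by (simp add: ys ab left_normed_def)
    then show ?thesis using BA left_normed_set_closed by (simp add: commutator_eq_one_iff)
  qed
  have sub: "left_normed_set c1 \<subseteq> left_normed_set c2" using c by (rule left_normed_set_antimono)
  have gc: "g j \<in> carrier G" for j using g by auto
  have lx: "left_normed G (map g [1..<c1 + 2]) \<in> left_normed_set c1"
    and ly: "left_normed G (map (\<lambda>j. g (c1 + 1 + j)) [1..<c2 + 2]) \<in> left_normed_set c2"
    using gc by (auto intro!: left_normed_setI simp del: upt_Suc)
  show ?thesis
  proof (rule homI)
    fix x assume "x \<in> carrier G"
    then show "word_value G (g(i := x)) ?w \<in> carrier G"
      using gc by (intro word_value_closed) auto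
  next
    fix x y assume x: "x \<in> carrier G" and y: "y \<in> carrier G"
    show "word_value G (g(i := x \<otimes> y)) ?w = word_value G (g(i := x)) ?w \<otimes> word_value G (g(i := y)) ?w"
    proof (cases "i \<le> c1 + 1")
      case True
      define ps qs where "ps = map g [1..<i]" and "qs = map g [Suc i..<c1 + 2]"
      define B where "B = left_normed G (map (\<lambda>j. g (c1 + 1 + j)) [1..<c2 + 2])"
      have "map (\<lambda>j. (g(i := z)) (c1 + 1 + j)) [1..<c2 + 2] = map (\<lambda>j. g (c1 + 1 + j)) [1..<c2 + 2]" for z
        using True by (auto simp del: upt_Suc)
      moreover have "map (g(i := z)) [1..<c1 + 2] = ps @ z # qs" for z
        unfolding ps_def qs_def using True i by (intro map_upt_fun_upd) auto
      ultimately have e: "word_value G (g(i := z)) ?w = commutator G (left_normed G (ps @ z # qs)) B" for z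
        by (simp only: word_value_nilp_comm_word B_def)
      show ?thesis unfolding e
      proof (rule commutator_left_normed_mult[OF comm12])
        \<comment> \<open>[A, B] has weight c1 + 2, and \<open>A'\<close> is also a commutator of
          weight c2 + 1 because c2 \<le> c1, so \<open>comm12\<close> applies.\<close>
        show "commutator G A B \<otimes> A' = A' \<otimes> commutator G A B"
          if "A \<in> left_normed_set c1" "A' \<in> left_normed_set c1" "B \<in> left_normed_set c2" for A A' B
          using that sub by (intro comm12 commutator_in_left_normed_set)
            (auto simp: left_normed_set_closed)
        show "length ps + length qs = c1" using True i by (auto simp: ps_def qs_def)
        show "set ps \<subseteq> carrier G" "set qs \<subseteq> carrier G" using gc by (auto simp: ps_def qs_def)
        show "B \<in> left_normed_set c2" using ly by (simp add: B_def)
      qed (use x y in auto)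
    next
      case False
      define h k where "h = (\<lambda>j. g (c1 + 1 + j))" and "k = i - (c1 + 1)"
      define ps qs where "ps = map h [1..<k]" and "qs = map h [Suc k..<c2 + 2]"
      define A where "A = left_normed G (map g [1..<c1 + 2])"
      have "map (g(i := z)) [1..<c1 + 2] = map g [1..<c1 + 2]" for z
        using False by (auto simp del: upt_Suc)
      moreover have "(\<lambda>j. (g(i := z)) (c1 + 1 + j)) = h(k := z)" for z
        using False by (auto simp: h_def k_def fun_eq_iff)
      moreover have "map (h(k := z)) [1..<c2 + 2] = ps @ z # qs" for z
        unfolding ps_def qs_def using False i by (intro map_upt_fun_upd) (auto simp: k_def)
      ultimately have e: "word_value G (g(i := z)) ?w = commutator G A (left_normed G (ps @ z # qs))" for z
        unfolding word_value_nilp_comm_word A_def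
        by (simp only:)
      have lq: "length ps + length qs = c2" using False i by (auto simp: ps_def qs_def k_def)
      have cl: "set ps \<subseteq> carrier G" "set qs \<subseteq> carrier G" using gc by (auto simp: ps_def qs_def h_def)
      have A: "A \<in> left_normed_set c1" using lx by (simp add: A_def)
      have ln: "left_normed G (ps @ z # qs) \<in> left_normed_set c2" if "z \<in> carrier G" for z
        using lq cl that by (intro left_normed_setI) auto
      \<comment> \<open>For an entry of the second bracket, the two brackets are exchanged first and
        the result is inverted afterwards.\<close>
      have "commutator G (left_normed G (ps @ (x \<otimes> y) # qs)) A =
        commutator G (left_normed G (ps @ x # qs)) A \<otimes> commutator G (left_normed G (ps @ y # qs)) A"
      proof (rule commutator_left_normed_mult[OF comm21 _ lq cl x y A])
        show "commutator G B A \<otimes> B' = B' \<otimes> commutator G B A"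
          if "B \<in> left_normed_set c2" "B' \<in> left_normed_set c2" "A \<in> left_normed_set c1" for A B B'
        proof -
          have "commutator G A B \<otimes> B' = B' \<otimes> commutator G A B"
            using that by (intro comm12 commutator_in_left_normed_set) (auto simp: left_normed_set_closed)
          moreover have "commutator G B A = inv (commutator G A B)"
            using that by (simp add: inv_commutator left_normed_set_closed)
          ultimately show ?thesis
            using that by (auto simp: left_normed_set_closed intro!: commute_inv)
        qed
      qed
      moreover have "commutator G A (left_normed G (ps @ z # qs)) =
          inv (commutator G (left_normed G (ps @ z # qs)) A)" if "z \<in> carrier G" for z
        using A ln[OF that] by (simp add: inv_commutator left_normed_set_closed)
      \<comment> \<open>Inverting reverses the product, so the two values have to commute. Both have
        weight c1 + 2, and one of them is read as a commutator of weight c2 + 1.\<close>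
      moreover have "commutator G A (left_normed G (ps @ x # qs)) \<otimes> commutator G A (left_normed G (ps @ y # qs)) =
          commutator G A (left_normed G (ps @ y # qs)) \<otimes> commutator G A (left_normed G (ps @ x # qs))"
        using A ln[OF x] ln[OF y] sub
        by (intro comm12 subsetD[OF left_normed_set_antimono[of c2 "Suc c1"]]
          commutator_in_left_normed_set) (use c in \<open>auto simp: left_normed_set_closed\<close>)
      ultimately show ?thesis unfolding e using x y A ln[OF x] ln[OF y]
        by (simp add: inv_mult_group left_normed_set_closed)
    qed
  qed
qed

end

lemma word_value_nilp_comm_word_cong:
  assumes "\<And>i. 1 \<le> i \<Longrightarrow> i \<le> c1 + c2 + 2 \<Longrightarrow> g i = g' i"
  shows "word_value G g (nilp_comm_word c1 c2) = word_value G g' (nilp_comm_word c1 c2)"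
proof -
  have "map g [1..<c1 + 2] = map g' [1..<c1 + 2]"
    "map (\<lambda>j. g (c1 + 1 + j)) [1..<c2 + 2] = map (\<lambda>j. g' (c1 + 1 + j)) [1..<c2 + 2]"
    using assms by (auto simp del: upt_Suc)
  then show ?thesis by (simp only: word_value_nilp_comm_word)
qed

text \<open>The innermost commutator [x_1, x_2] is trivial; c1 \<ge> 1 places both variables in the
  first bracket.\<close>

lemma (in group) word_value_nilp_comm_word_repeated:
  assumes "range g \<subseteq> carrier G" "1 \<le> c1" "g 1 = g 2"
  shows "word_value G g (nilp_comm_word c1 c2) = \<one>"
proof -
  have gc: "g i \<in> carrier G" for i using assms(1) by auto
  have "[1..<c1 + 2] = 1 # 2 # [3..<c1 + 2]"
    using assms(2) upt_conv_Cons[of 1 "c1 + 2"] upt_conv_Cons[of 2 "c1 + 2"]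
    by (simp add: numeral_2_eq_2 numeral_3_eq_3 del: upt_Suc)
  then have "left_normed G (map g [1..<c1 + 2]) = iterated_commutator G (commutator G (g 1) (g 2)) (map g [3..<c1 + 2])"
    by (simp add: left_normed_def)
  also have "\<dots> = iterated_commutator G \<one> (map g [3..<c1 + 2])"
    using gc assms(3) by (metis commutator_eq_one_iff)
  also have "\<dots> = \<one>" using gc by (intro iterated_commutator_one) auto
  finally have 1: "left_normed G (map g [1..<c1 + 2]) = \<one>" .
  have "left_normed G (map (\<lambda>j. g (c1 + 1 + j)) [1..<c2 + 2]) \<in> carrier G"
    using gc by (intro left_normed_closed) (auto simp del: upt_Suc)
  then show ?thesis unfolding word_value_nilp_comm_word 1 by (simp add: commutator_def)
qed

lemma (in group_hom) hom_commutator: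
  "x \<in> carrier G \<Longrightarrow> y \<in> carrier G \<Longrightarrow> h (commutator G x y) = commutator H (h x) (h y)"
  by (simp add: commutator_def)

lemma (in normal) rcoset_eq_iff:
  assumes "x \<in> carrier G" "y \<in> carrier G"
  shows "H #> x = H #> y \<longleftrightarrow> inv y \<otimes> x \<in> H"
proof
  assume "H #> x = H #> y"
  then have "x \<in> H #> y" using rcos_self[OF assms(1) subgroup_axioms] by simp
  then obtain h where h: "h \<in> H" "x = h \<otimes> y" by (auto simp: r_coset_def)
  then show "inv y \<otimes> x \<in> H"
    using assms inv_op_closed1[OF assms(2) h(1)] subset by (auto simp: m_assoc)
next
  assume h: "inv y \<otimes> x \<in> H"
  have "H #> x = H #> (y \<otimes> (inv y \<otimes> x))" using assms by simp
  also have "\<dots> = (H #> y) #> (inv y \<otimes> x)" using assms subset by (simp add: coset_mult_assoc)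
  also have "\<dots> = (y <# H) #> (inv y \<otimes> x)" using assms coset_eq by simp
  also have "\<dots> = y <# (H #> (inv y \<otimes> x))" using assms subset by (simp add: coset_assoc)
  also have "\<dots> = H #> y" using h assms coset_eq by (simp add: coset_join2[OF _ subgroup_axioms])
  finally show "H #> x = H #> y" .
qed

text \<open>
  The word is multilinear on the abelian quotient \<open>G / M\<close>. If all \<open>m\<close>-th powers are multiples of the
  single element \<open>m b\<close>, moving the factor \<open>m\<close> to the alternating pair \<open>x\<^sub>1, x\<^sub>2\<close> shows that \<open>m\<close>
  kills all values.
\<close>

lemma (in group) marginal_quotient_exponent:
  fixes c1 c2 m :: nat
  defines "M \<equiv> marginal_subgroup {nilp_comm_word c1 c2} G"
  assumes comm: "comm_group (G Mod M)" and c: "c2 \<le> c1" "1 \<le> c1"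
    and b: "b \<in> carrier (G Mod M)"
    and pow: "\<And>x. x \<in> carrier (G Mod M) \<Longrightarrow>
      \<exists>z::int. x [^]\<^bsub>G Mod M\<^esub> m = (b [^]\<^bsub>G Mod M\<^esub> m) [^]\<^bsub>G Mod M\<^esub> z"
  shows "b [^]\<^bsub>G Mod M\<^esub> m = \<one>\<^bsub>G Mod M\<^esub>"
proof -
  let ?w = "nilp_comm_word c1 c2"
  have M: "M \<lhd> G" unfolding M_def by (rule marginal_subgroup_normal)
  interpret M: normal M G by fact
  interpret Q: comm_group "G Mod M" by fact
  define q where "q = (\<lambda>x. M #> x)"
  have q: "q \<in> hom G (G Mod M)" unfolding q_def by (rule M.r_coset_hom_Mod)
  interpret q: group_hom G "G Mod M" q
    using q by unfold_locales
  have q_eq: "q x = q y \<longleftrightarrow> inv y \<otimes> x \<in> M" if "x \<in> carrier G" "y \<in> carrier G" for x y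
    unfolding q_def using that by (rule M.rcoset_eq_iff)
  have qs: "\<exists>x \<in> carrier G. q x = y" if "y \<in> carrier (G Mod M)" for y
    using that by (auto simp: q_def FactGroup_def RCOSETS_def)
  have V: "commutator G x y \<in> M" if "x \<in> carrier G" "y \<in> carrier G" for x y
  proof -
    have "q (commutator G x y) = commutator (G Mod M) (q x) (q y)"
      using that by (rule q.hom_commutator)
    also have "\<dots> = \<one>\<^bsub>G Mod M\<^esub>"
      using that Q.m_comm by (simp only: Q.commutator_eq_one_iff q.hom_closed)
    finally have "q (commutator G x y) = q \<one>" by (simp only: q.hom_one)
    then have "inv \<one> \<otimes> commutator G x y \<in> M"
      using that by (simp only: q_eq commutator_closed one_closed)
    then show ?thesis using that by simp
  qed
  have hom: "(\<lambda>x. word_value G (g(i := x)) ?w) \<in> hom G G"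
    if "range g \<subseteq> carrier G" "1 \<le> i" "i \<le> c1 + c2 + 2" for g i
    using nilp_word_hom[OF _ c(1) that] V unfolding M_def by blast
  \<comment> \<open>Changing an entry within its coset is a marginal shift, so values depend on
    cosets only.\<close>
  have inv: "word_value G (g(i := x)) ?w = word_value G (g(i := y)) ?w"
    if g: "range g \<subseteq> carrier G" and x: "x \<in> carrier G" and y: "y \<in> carrier G" and e: "q x = q y" for g i x y
  proof -
    have "inv y \<otimes> x \<in> M" using q_eq[OF x y] e by simp
    moreover have "range (g(i := y)) \<subseteq> carrier G" using g y by auto
    ultimately have "word_value G ((g(i := y))(i := (g(i := y)) i \<otimes> (inv y \<otimes> x))) ?w = word_value G (g(i := y)) ?w"
      unfolding M_def by (intro marginal_subgroupD) auto
    then show ?thesis using x y by simp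
  qed
  obtain a where a: "a \<in> carrier G" "q a = b" using qs[OF b] by blast
  have powG: "\<exists>z::int. q (x [^] m) = q ((a [^] m) [^] z)" if "x \<in> carrier G" for x
    using pow[of "q x"] that a by (auto simp: q.hom_nat_pow q.hom_int_pow)
  \<comment> \<open>The exponent \<open>m\<close> moves onto entry \<open>i\<close>, whose m-th
    power agrees modulo \<open>M\<close> with a power of \<open>a [^] m\<close>, and then moves out
    again: up to an outer exponent, entry \<open>i\<close> becomes \<open>a\<close>.\<close>
  have reduce: "\<exists>z::int. word_value G g ?w [^] m = (word_value G (g(i := a)) ?w [^] m) [^] z"
    if g: "range g \<subseteq> carrier G" and i: "1 \<le> i" "i \<le> c1 + c2 + 2" for g i
  proof -
    define f where "f = (\<lambda>x. word_value G (g(i := x)) ?w)"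
    have f: "group_hom G G f" using hom[OF that] unfolding f_def by unfold_locales
    have gi: "g i \<in> carrier G" using g by auto
    obtain z :: int where z: "q (g i [^] m) = q ((a [^] m) [^] z)" using powG[OF gi] by blast
    have "f (g i [^] m) = f ((a [^] m) [^] z)"
      unfolding f_def using inv[OF g _ _ z] gi a by simp
    then have "f (g i) [^] m = (f a [^] m) [^] z"
      using gi a by (simp add: group_hom.hom_nat_pow[OF f] group_hom.hom_int_pow[OF f])
    then show ?thesis unfolding f_def by auto
  qed
  \<comment> \<open>Two reductions put \<open>a\<close> into both x_1 and x_2, where the word is
    alternating.\<close>
  have kill: "word_value G g ?w [^] m = \<one>" if g: "range g \<subseteq> carrier G" for g
  proof -
    define g1 where "g1 = g(1 := a)"
    define g2 where "g2 = g1(2 := a)"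
    have g1: "range g1 \<subseteq> carrier G" and g2: "range g2 \<subseteq> carrier G"
      using g a by (auto simp: g1_def g2_def)
    have "word_value G g2 ?w = \<one>"
      using word_value_nilp_comm_word_repeated[OF g2 c(2)] by (simp add: g2_def g1_def)
    then have "word_value G g1 ?w [^] m = \<one>"
      using reduce[OF g1, of 2] c by (auto simp: g2_def)
    then show ?thesis using reduce[OF g, of 1] by (auto simp: g1_def)
  qed
  \<comment> \<open>By multiplicativity, a shift of entry \<open>i\<close> by \<open>a [^] m\<close>
    multiplies the value by an m-th power of a value, which \<open>kill\<close> makes
    trivial.\<close>
  have "a [^] m \<in> M" unfolding M_def marginal_subgroup_def
  proof (clarsimp simp del: fun_upd_apply, intro conjI allI impI)
    show "a [^] m \<in> carrier G" using a by simp
    fix g :: "nat \<Rightarrow> 'a" and i assume g: "range g \<subseteq> carrier G"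
    then have gi: "g i \<in> carrier G" by auto
    show "word_value G (g(i := g i \<otimes> a [^] m)) ?w = word_value G g ?w"
    proof (cases "1 \<le> i \<and> i \<le> c1 + c2 + 2")
      case False
      then show ?thesis by (intro word_value_nilp_comm_word_cong) auto
    next
      case True
      define f where "f = (\<lambda>x. word_value G (g(i := x)) ?w)"
      have f: "group_hom G G f" using hom[OF g] True unfolding f_def by unfold_locales auto
      interpret f: group_hom G G f by fact
      have "f a [^] m = \<one>" unfolding f_def using g a by (intro kill) auto
      then have "f (g i \<otimes> a [^] m) = f (g i)" using gi a by (simp add: f.hom_nat_pow)
      then show ?thesis by (simp add: f_def)
    qed
  qed
  then have "q (a [^] m) = M" using a coset_join2[OF _ M.subgroup_axioms] by (simp add: q_def)
  moreover have "q (a [^] m) = b [^]\<^bsub>G Mod M\<^esub> m" using a q.hom_nat_pow[OF a(1), of m] by simp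
  ultimately show ?thesis by simp
qed

section \<open>Rank at least two is necessary\<close>

lemma group_fg_abelian_sum: "group (fg_abelian_sum k t n)"
  unfolding fg_abelian_sum_def by (intro DirProd_group sum_group) auto

lemma carrier_fg_abelian_sum:
  assumes "\<And>i. 1 \<le> i \<Longrightarrow> i \<le> t \<Longrightarrow> n i > 0"
  shows "carrier (fg_abelian_sum k t n) =
    (\<Pi>\<^sub>E i\<in>{1..k}. UNIV) \<times> (\<Pi>\<^sub>E i\<in>{1..t}. {0..<int (n i)})"
proof -
  have "(\<Pi>\<^sub>E i\<in>{1..t}. carrier (integer_mod_group (n i))) = (\<Pi>\<^sub>E i\<in>{1..t}. {0..<int (n i)})"
    using assms by (intro PiE_cong) (auto simp: carrier_integer_mod_group)
  then show ?thesis by (simp add: fg_abelian_sum_def carrier_sum_group)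
qed

lemma one_fg_abelian_sum: "\<one>\<^bsub>fg_abelian_sum k t n\<^esub> = (\<lambda>i\<in>{1..k}. 0, \<lambda>i\<in>{1..t}. 0)"
  by (simp add: fg_abelian_sum_def)

lemma mult_fg_abelian_sum:
  "x \<otimes>\<^bsub>fg_abelian_sum k t n\<^esub> y =
    (\<lambda>i\<in>{1..k}. fst x i + fst y i, \<lambda>i\<in>{1..t}. (snd x i + snd y i) mod int (n i))"
  by (simp add: fg_abelian_sum_def mult_DirProd')

lemma nat_pow_fg_abelian_sum:
  "x [^]\<^bsub>fg_abelian_sum k t n\<^esub> (m::nat) =
    (\<lambda>i\<in>{1..k}. int m * fst x i, \<lambda>i\<in>{1..t}. (int m * snd x i) mod int (n i))"
  by (induction m)
    (auto simp: one_fg_abelian_sum mult_fg_abelian_sum fun_eq_iff algebra_simps mod_add_left_eq mod_add_right_eq)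

lemma int_pow_fg_abelian_sum:
  assumes x: "x \<in> carrier (fg_abelian_sum k t n)" and n: "\<And>i. 1 \<le> i \<Longrightarrow> i \<le> t \<Longrightarrow> n i > 0"
  shows "x [^]\<^bsub>fg_abelian_sum k t n\<^esub> (z::int) =
    (\<lambda>i\<in>{1..k}. z * fst x i, \<lambda>i\<in>{1..t}. (z * snd x i) mod int (n i))"
proof -
  interpret F: group "fg_abelian_sum k t n" by (rule group_fg_abelian_sum)
  show ?thesis
  proof (cases z)
    case (nonneg p)
    then show ?thesis by (simp add: nat_pow_fg_abelian_sum int_pow_int)
  next
    case (neg p)
    define y where "y = (\<lambda>i\<in>{1..k}. z * fst x i, \<lambda>i\<in>{1..t}. (z * snd x i) mod int (n i))"
    have yc: "y \<in> carrier (fg_abelian_sum k t n)"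
      by (auto simp: y_def carrier_fg_abelian_sum n)
    have "y \<otimes>\<^bsub>fg_abelian_sum k t n\<^esub> (x [^]\<^bsub>fg_abelian_sum k t n\<^esub> Suc p) = \<one>\<^bsub>fg_abelian_sum k t n\<^esub>"
      unfolding mult_fg_abelian_sum nat_pow_fg_abelian_sum one_fg_abelian_sum y_def neg
      by (auto simp: fun_eq_iff mod_add_eq simp flip: distrib_right)
    then have "inv\<^bsub>fg_abelian_sum k t n\<^esub> (x [^]\<^bsub>fg_abelian_sum k t n\<^esub> Suc p) = y"
      using x yc by (intro F.inv_equality) auto
    moreover have "x [^]\<^bsub>fg_abelian_sum k t n\<^esub> z = inv\<^bsub>fg_abelian_sum k t n\<^esub> (x [^]\<^bsub>fg_abelian_sum k t n\<^esub> Suc p)"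
      using x unfolding neg by (rule F.int_pow_neg_int)
    ultimately show ?thesis by (simp add: y_def)
  qed
qed

text \<open>Rank 0 makes the group finite. For rank 1 let \<open>m\<close> be the product of the
  torsion orders and \<open>b\<close> a generator of the free part: every m-th power is a power of
  the m-th power of \<open>b\<close>, so \<open>marginal_quotient_exponent\<close> would give
  \<open>b\<close> finite order.\<close>

lemma capable_imp_rank_ge_2:
  fixes G :: "('a, 'b) monoid_scheme"
  assumes capable: "variety_capable TYPE('e) {nilp_comm_word c1 c2} G"
    and c: "c2 \<le> c1" "1 \<le> c1"
    and n: "\<And>i. 1 \<le> i \<Longrightarrow> i \<le> t \<Longrightarrow> n i > 0"
    and G: "comm_group G" "infinite (carrier G)"
    and iso: "G \<cong> fg_abelian_sum k t n"
  shows "k \<ge> 2"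
proof (rule ccontr)
  assume "\<not> k \<ge> 2"
  then consider "k = 0" | "k = 1" by linarith
  then show False
  proof cases
    case 1
    have "finite (carrier (fg_abelian_sum k t n))"
      using 1 by (simp add: carrier_fg_abelian_sum n finite_PiE)
    moreover obtain h where "bij_betw h (carrier G) (carrier (fg_abelian_sum k t n))"
      using iso by (auto simp: is_iso_def iso_def)
    ultimately show False using G(2) by (simp add: bij_betw_finite)
  next
    case 2
    interpret G: comm_group G by fact
    define F where "F = fg_abelian_sum k t n"
    interpret F: group F unfolding F_def by (rule group_fg_abelian_sum)
    obtain E :: "'e monoid" where E: "group E" and
      "G \<cong> E Mod marginal_subgroup {nilp_comm_word c1 c2} E"
      using capable by (auto simp: variety_capable_def)
    define Q where "Q = E Mod marginal_subgroup {nilp_comm_word c1 c2} E"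
    interpret E: group E by fact
    have Q: "group Q"
      unfolding Q_def by (intro normal.factorgroup_is_group E.marginal_subgroup_normal)
    have "G \<cong> Q" unfolding Q_def by fact
    then have commQ: "comm_group Q"
      using Q by (intro G.iso_imp_comm_group) (auto simp: group.is_monoid)
    have "F \<cong> Q" using G.iso_sym[OF iso] \<open>G \<cong> Q\<close> unfolding F_def by (rule iso_trans)
    then obtain h where h: "h \<in> iso F Q" by (auto simp: is_iso_def)
    interpret Q: group Q by fact
    interpret h: group_hom F Q h using h by unfold_locales (simp add: iso_def)
    define m where "m = (\<Prod>i\<in>{1..t}. n i)"
    have m: "m > 0" unfolding m_def using n by (intro prod_pos) auto
    have dvd: "int m * y mod int (n i) = 0" if "i \<in> {1..t}" for i y
    proof -
      have "n i dvd m" unfolding m_def using that by (intro dvd_prodI) auto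
      then show ?thesis by simp
    qed
    define b where "b = ((\<lambda>i\<in>{1..k}. 1, \<lambda>i\<in>{1..t}. 0) :: (nat \<Rightarrow> int) \<times> (nat \<Rightarrow> int))"
    have b: "b \<in> carrier F" unfolding F_def b_def using n by (auto simp: carrier_fg_abelian_sum n)
    have pow: "x [^]\<^bsub>F\<^esub> m = (b [^]\<^bsub>F\<^esub> m) [^]\<^bsub>F\<^esub> fst x 1" if "x \<in> carrier F" for x
    proof -
      have "b [^]\<^bsub>F\<^esub> m \<in> carrier F" using b by simp
      then show ?thesis
        unfolding F_def by (subst int_pow_fg_abelian_sum)
         (auto simp: n nat_pow_fg_abelian_sum dvd 2 b_def fun_eq_iff)
    qed
    have "h b [^]\<^bsub>Q\<^esub> m = \<one>\<^bsub>Q\<^esub>"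
      unfolding Q_def
    proof (rule E.marginal_quotient_exponent[OF _ c], fold Q_def)
      show "h b \<in> carrier Q" using b by simp
      fix x assume "x \<in> carrier Q"
      moreover have "carrier Q = h ` carrier F" using h by (auto simp: iso_def bij_betw_def)
      ultimately obtain y where y: "y \<in> carrier F" "x = h y" by blast
      then have "x [^]\<^bsub>Q\<^esub> m = h (y [^]\<^bsub>F\<^esub> m)" by (simp add: h.hom_nat_pow)
      also have "\<dots> = (h b [^]\<^bsub>Q\<^esub> m) [^]\<^bsub>Q\<^esub> fst y 1"
        unfolding pow[OF y(1)] using b by (simp add: h.hom_nat_pow h.hom_int_pow)
      finally show "\<exists>z::int. x [^]\<^bsub>Q\<^esub> m = (h b [^]\<^bsub>Q\<^esub> m) [^]\<^bsub>Q\<^esub> z" by blast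
    qed (rule commQ)
    then have "h (b [^]\<^bsub>F\<^esub> m) = h \<one>\<^bsub>F\<^esub>" using b by (simp add: h.hom_nat_pow)
    then have "b [^]\<^bsub>F\<^esub> m = \<one>\<^bsub>F\<^esub>"
      using h b by (auto simp: iso_def bij_betw_def inj_on_def)
    then show False
      using m by (auto simp: F_def nat_pow_fg_abelian_sum one_fg_abelian_sum b_def 2 fun_eq_iff
        split: if_splits)
  qed
qed

section \<open>A capability criterion\<close>

lemma (in group_hom) word_value_hom:
  assumes "range g \<subseteq> carrier G"
  shows "word_value H (\<lambda>i. h (g i)) v = h (word_value G g v)"
  using assms by (induction v) (auto simp: G.word_value_closed)

text \<open>The first isomorphism theorem, applied to two surjections with the same kernel.\<close>

lemma (in group_hom) iso_of_kernel_eq: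
  assumes "group_hom G H' h'" and "h ` carrier G = carrier H" and "h' ` carrier G = carrier H'"
    and "\<And>x. x \<in> carrier G \<Longrightarrow> h x = \<one>\<^bsub>H\<^esub> \<longleftrightarrow> h' x = \<one>\<^bsub>H'\<^esub>"
  shows "H \<cong> H'"
proof -
  have "kernel G H h = kernel G H' h'" using assms(4) by (auto simp: kernel_def)
  moreover have "group (G Mod kernel G H h)"
    by (intro normal.factorgroup_is_group normal_kernel)
  ultimately show ?thesis
    using FactGroup_iso[OF assms(2)] group_hom.FactGroup_iso[OF assms(1,3)]
    by (metis group.iso_sym iso_trans)
qed

text \<open>The group E is H / K, presented through a map \<open>f\<close> that is constant exactly
  on the cosets of \<open>K\<close>; countability allows a copy of it in the type \<open>'e\<close>.
  The hypothesis \<open>kernel\<close> states, without mention of the quotient, that the kernel of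
  \<open>\<phi>\<close> is the preimage of the marginal subgroup of E.\<close>

lemma variety_capableI:
  fixes H :: "('h, 'd) monoid_scheme" and G :: "('a, 'b) monoid_scheme" and f :: "'h \<Rightarrow> 'c"
  assumes infinite: "infinite (UNIV :: 'e set)"
    and f: "weak_group_morphism f K H" and count: "countable (f ` carrier H)"
    and phi: "group_hom H G \<phi>" "\<phi> ` carrier H = carrier G"
    and kernel: "\<And>h. h \<in> carrier H \<Longrightarrow> \<phi> h = \<one>\<^bsub>G\<^esub> \<longleftrightarrow>
      (\<forall>v \<in> V. \<forall>g. range g \<subseteq> carrier H \<longrightarrow> (\<forall>i.
        f (word_value H (g(i := g i \<otimes>\<^bsub>H\<^esub> h)) v) = f (word_value H g v)))"
  shows "variety_capable TYPE('e) V G"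
proof -
  interpret phi: group_hom H G \<phi> by fact
  obtain \<iota> :: "nat \<Rightarrow> 'e" where "inj \<iota>"
    using infinite_countable_subset[OF infinite] by blast
  moreover obtain \<tau> :: "'c \<Rightarrow> nat" where "inj_on \<tau> (f ` carrier H)"
    using count by (auto simp: countable_def)
  ultimately have inj: "inj_on (\<iota> \<circ> \<tau>) (f ` carrier H)"
    by (auto intro: comp_inj_on inj_on_subset)
  \<comment> \<open>The injections only rename the values of \<open>f\<close>, so \<open>q\<close>
    has the same fibres on the carrier.\<close>
  define q where "q = (\<lambda>x. (\<iota> \<circ> \<tau>) (f x))"
  have q_eq: "q x = q y \<longleftrightarrow> f x = f y" if "x \<in> carrier H" "y \<in> carrier H" for x y
    unfolding q_def using that by (intro inj_on_eq_iff[OF inj]) auto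
  have q: "weak_group_morphism q K H"
    using f by (auto simp: weak_group_morphism_def weak_group_morphism_axioms_def q_eq)
  define E where "E = image_group q H"
  interpret E: group E unfolding E_def by (rule phi.G.image_group_is_group[OF q])
  have "q \<in> hom H E" unfolding E_def by (rule phi.G.weak_group_morphism_is_hom[OF q])
  then interpret q: group_hom H E q by unfold_locales
  have surj: "q ` carrier H = carrier E" by (simp add: E_def image_group_carrier)
  define M where "M = marginal_subgroup V E"
  have M: "M \<lhd> E" unfolding M_def by (rule E.marginal_subgroup_normal)
  interpret M: normal M E by fact
  have marg: "q h \<in> M \<longleftrightarrow> \<phi> h = \<one>\<^bsub>G\<^esub>" if h: "h \<in> carrier H" for h
  proof -
    have 1: "word_value E ((\<lambda>j. q (g j))(i := q (g i) \<otimes>\<^bsub>E\<^esub> q h)) v = word_value E (\<lambda>j. q (g j)) v \<longleftrightarrow>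
        f (word_value H (g(i := g i \<otimes>\<^bsub>H\<^esub> h)) v) = f (word_value H g v)"
      if g: "range g \<subseteq> carrier H" for g i v
    proof -
      have gc: "g j \<in> carrier H" for j using g by auto
      have g': "range (g(i := g i \<otimes>\<^bsub>H\<^esub> h)) \<subseteq> carrier H" using gc h by auto
      have "(\<lambda>j. q (g j))(i := q (g i) \<otimes>\<^bsub>E\<^esub> q h) = (\<lambda>j. q ((g(i := g i \<otimes>\<^bsub>H\<^esub> h)) j))"
        using gc h by (auto simp: fun_eq_iff)
      then show ?thesis
        using q.word_value_hom[OF g] q.word_value_hom[OF g'] q_eq phi.G.word_value_closed g g'
        by simp
    qed
    \<comment> \<open>Assignments into E lift along the surjection \<open>q\<close>, so
      quantification over assignments can take place in H.\<close>
    have 2: "(\<forall>g. range g \<subseteq> carrier E \<longrightarrow> P g) \<longleftrightarrow> (\<forall>g. range g \<subseteq> carrier H \<longrightarrow> P (\<lambda>j. q (g j)))"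
      for P :: "(nat \<Rightarrow> 'e) \<Rightarrow> bool"
    proof (intro iffI allI impI)
      fix g :: "nat \<Rightarrow> 'h" assume "\<forall>g. range g \<subseteq> carrier E \<longrightarrow> P g" "range g \<subseteq> carrier H"
      then show "P (\<lambda>j. q (g j))" by (auto simp: image_subset_iff)
    next
      fix g :: "nat \<Rightarrow> 'e"
      assume *: "\<forall>g. range g \<subseteq> carrier H \<longrightarrow> P (\<lambda>j. q (g j))" and g: "range g \<subseteq> carrier E"
      have "\<forall>j. \<exists>x \<in> carrier H. g j = q x" using g surj by (auto simp: image_iff subset_iff)
      then obtain g' where g': "\<And>j. g' j \<in> carrier H" "\<And>j. g j = q (g' j)" by metis
      have "g = (\<lambda>j. q (g' j))" by (rule ext) (rule g'(2))
      then show "P g" using * g'(1) by auto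
    qed
    show ?thesis
      unfolding kernel[OF h] M_def marginal_subgroup_def 2 using h 1 by auto
  qed
  define p where "p = (\<lambda>x. M #>\<^bsub>E\<^esub> q x)"
  have "p \<in> hom H (E Mod M)"
    using hom_compose[OF q.homh M.r_coset_hom_Mod] by (simp add: p_def comp_def)
  then have p: "group_hom H (E Mod M) p"
    by (intro group_hom.intro group_hom_axioms.intro M.factorgroup_is_group) (rule phi.G.is_group)
  have "p ` carrier H = (\<lambda>x. M #>\<^bsub>E\<^esub> x) ` carrier E" by (simp add: p_def image_image flip: surj)
  also have "\<dots> = carrier (E Mod M)" by (auto simp: FactGroup_def RCOSETS_def)
  finally have ps: "p ` carrier H = carrier (E Mod M)" .
  have "\<phi> h = \<one>\<^bsub>G\<^esub> \<longleftrightarrow> p h = \<one>\<^bsub>E Mod M\<^esub>" if "h \<in> carrier H" for h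
  proof -
    have "p h = \<one>\<^bsub>E Mod M\<^esub> \<longleftrightarrow> M #>\<^bsub>E\<^esub> q h = M #>\<^bsub>E\<^esub> \<one>\<^bsub>E\<^esub>"
      by (simp add: p_def M.subset)
    also have "\<dots> \<longleftrightarrow> q h \<in> M" using that M.rcoset_eq_iff[of "q h" "\<one>\<^bsub>E\<^esub>"] by simp
    finally show ?thesis using marg[OF that] by simp
  qed
  then have "G \<cong> E Mod M" by (rule phi.iso_of_kernel_eq[OF p phi(2) ps])
  then show ?thesis unfolding variety_capable_def M_def using E.is_group by blast
qed

section \<open>Noncommutative power series\<close>

text \<open>A type of its own for the functions on words, so that it can carry a ring structure with
  the convolution product.\<close>

typedef 'x series = "UNIV :: ('x list \<Rightarrow> int) set"
  morphisms coeff Series ..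

lemmas coeff_Series [simp] = Series_inverse[OF UNIV_I]

lemma series_eqI: "(\<And>w. coeff f w = coeff g w) \<Longrightarrow> f = g"
  by (simp add: coeff_inject[symmetric] fun_eq_iff)

instantiation series :: (type) ring_1
begin

definition "0 = Series (\<lambda>w. 0)"
definition "1 = Series (\<lambda>w. if w = [] then 1 else 0)"
definition "f + g = Series (\<lambda>w. coeff f w + coeff g w)"
definition "- f = Series (\<lambda>w. - coeff f w)"
definition "f - g = Series (\<lambda>w. coeff f w - coeff g w)"
definition "f * g = Series (\<lambda>w. \<Sum>i\<le>length w. coeff f (take i w) * coeff g (drop i w))"

lemma coeff_simps [simp]:
  "coeff 0 w = 0" "coeff 1 w = (if w = [] then 1 else 0)"
  "coeff (f + g) w = coeff f w + coeff g w" "coeff (- f) w = - coeff f w"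
  "coeff (f - g) w = coeff f w - coeff g w"
  by (simp_all add: zero_series_def one_series_def plus_series_def uminus_series_def minus_series_def)

lemma coeff_mult:
  "coeff (f * g) w = (\<Sum>i\<le>length w. coeff f (take i w) * coeff g (drop i w))"
  by (simp add: times_series_def)

instance
proof
  fix f g h :: "'a series"
  show "f * g * h = f * (g * h)"
  proof (rule series_eqI)
    fix w
    define a where "a i j = coeff f (take j w) * coeff g (take (i - j) (drop j w)) * coeff h (drop i w)" for i j
    have "coeff (f * g) (take i w) = (\<Sum>j\<le>i. coeff f (take j w) * coeff g (take (i - j) (drop j w)))"
      if "i \<le> length w" for i
      unfolding coeff_mult using that by (intro sum.cong) (auto simp: drop_take)
    then have "coeff (f * g * h) w = (\<Sum>i\<le>length w. \<Sum>j\<le>i. a i j)"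
      unfolding coeff_mult[of "f * g"] by (intro sum.cong) (auto simp: sum_distrib_right a_def)
    also have "\<dots> = (\<Sum>(i, j)\<in>Sigma {..length w} (\<lambda>i. {..i}). a i j)" by (simp add: sum.Sigma)
    \<comment> \<open>A cut of \<open>w\<close> into three pieces is described by its two cutting
      points j \<le> i, or by the first one and the length l = i - j of the middle piece.\<close>
    also have "\<dots> = (\<Sum>(j, l)\<in>Sigma {..length w} (\<lambda>j. {..length w - j}). a (j + l) j)"
      by (rule sum.reindex_bij_witness[where i = "\<lambda>(j, l). (j + l, j)" and j = "\<lambda>(i, j). (j, i - j)"]) auto
    also have "\<dots> = (\<Sum>j\<le>length w. \<Sum>l\<le>length w - j. a (j + l) j)" by (simp add: sum.Sigma)
    also have "\<dots> = coeff (f * (g * h)) w"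
      by (simp add: coeff_mult sum_distrib_left a_def mult.assoc add.commute)
    finally show "coeff (f * g * h) w = coeff (f * (g * h)) w" .
  qed
  show "1 * f = f"
  proof (rule series_eqI)
    fix w
    have "coeff (1 * f) w = (\<Sum>i\<le>length w. if i = 0 then coeff f w else 0)"
      unfolding coeff_mult by (intro sum.cong) auto
    then show "coeff (1 * f) w = coeff f w" by simp
  qed
  show "f * 1 = f"
  proof (rule series_eqI)
    fix w
    have "coeff (f * 1) w = (\<Sum>i\<le>length w. if i = length w then coeff f w else 0)"
      unfolding coeff_mult by (intro sum.cong) auto
    then show "coeff (f * 1) w = coeff f w" by simp
  qed
  show "(f + g) * h = f * h + g * h" "f * (g + h) = f * g + f * h"
    by (rule series_eqI, simp add: coeff_mult algebra_simps sum.distrib)+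
  show "(0 :: 'a series) \<noteq> 1"
  proof
    assume "(0 :: 'a series) = 1"
    then have "coeff (0 :: 'a series) [] = coeff 1 []" by simp
    then show False by simp
  qed
qed (auto intro: series_eqI)

end

section \<open>Order of vanishing, and the group of series with constant term 1\<close>

definition order_ge :: "nat \<Rightarrow> 'x series \<Rightarrow> bool" where
  "order_ge a f \<longleftrightarrow> (\<forall>w. length w < a \<longrightarrow> coeff f w = 0)"

lemma order_ge_0 [simp]: "order_ge 0 f"
  by (simp add: order_ge_def)

text \<open>In the lowest possible degree only the cut after \<open>a\<close> letters survives: any
  other one leaves a left piece shorter than \<open>a\<close> or a right piece shorter than
  \<open>b\<close>.\<close>

lemma coeff_mult_order:
  assumes "order_ge a f" "order_ge b g" "length w = a + b"
  shows "coeff (f * g) w = coeff f (take a w) * coeff g (drop a w)"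
proof -
  have "coeff (f * g) w = (\<Sum>i\<le>length w. if i = a then coeff f (take a w) * coeff g (drop a w) else 0)"
    unfolding coeff_mult
  proof (intro sum.cong refl)
    fix i assume "i \<in> {..length w}"
    then show "coeff f (take i w) * coeff g (drop i w) =
        (if i = a then coeff f (take a w) * coeff g (drop a w) else 0)"
      using assms by (cases i a rule: linorder_cases) (auto simp: order_ge_def)
  qed
  then show ?thesis using assms by simp
qed

lemma order_ge_mult:
  assumes "order_ge a f" "order_ge b g"
  shows "order_ge (a + b) (f * g)"
  unfolding order_ge_def
proof (intro allI impI)
  fix w :: "'a list" assume w: "length w < a + b"
  have "coeff f (take i w) * coeff g (drop i w) = 0" if "i \<le> length w" for i
    using assms w that by (cases "i < a") (auto simp: order_ge_def)
  then show "coeff (f * g) w = 0" unfolding coeff_mult by (intro sum.neutral) auto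
qed

lemma order_ge_diff: "order_ge a f \<Longrightarrow> order_ge a g \<Longrightarrow> order_ge a (f - g)"
  by (simp add: order_ge_def)

text \<open>Solving g f = 1 for the coefficient of g at \<open>w\<close>, where f has constant term
  1, gives this recursion over proper prefixes.\<close>

fun left_inverse_coeff :: "('x list \<Rightarrow> int) \<Rightarrow> 'x list \<Rightarrow> int" where
  "left_inverse_coeff f w = (if w = [] then 1
     else - (\<Sum>i<length w. left_inverse_coeff f (take i w) * f (drop i w)))"

declare left_inverse_coeff.simps [simp del]

definition unit_series :: "'x series monoid" where
  "unit_series = \<lparr>carrier = {f. coeff f [] = 1}, monoid.mult = (*), one = 1\<rparr>"

lemma carrier_unit_series: "f \<in> carrier unit_series \<longleftrightarrow> coeff f [] = 1"
  by (simp add: unit_series_def)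

lemma mult_unit_series [simp]: "f \<otimes>\<^bsub>unit_series\<^esub> g = f * g"
  by (simp add: unit_series_def)

lemma one_unit_series [simp]: "\<one>\<^bsub>unit_series\<^esub> = 1"
  by (simp add: unit_series_def)

lemma group_unit_series: "group unit_series"
proof (rule groupI)
  fix f :: "'a series" assume f: "f \<in> carrier unit_series"
  define g where "g = Series (left_inverse_coeff (coeff f))"
  have "coeff (g * f) w = coeff 1 w" for w
  proof (cases "w = []")
    case True
    then show ?thesis using f by (simp add: coeff_mult g_def left_inverse_coeff.simps carrier_unit_series)
  next
    case False
    have "coeff (g * f) w = (\<Sum>i<length w. coeff g (take i w) * coeff f (drop i w)) + coeff g w * coeff f []"
      by (simp add: coeff_mult lessThan_Suc_atMost[symmetric])
    also have "\<dots> = 0"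
      using False f by (simp add: g_def carrier_unit_series left_inverse_coeff.simps[of _ w])
    finally show ?thesis using False by simp
  qed
  then show "\<exists>g \<in> carrier unit_series. g \<otimes>\<^bsub>unit_series\<^esub> f = \<one>\<^bsub>unit_series\<^esub>"
    by (intro bexI[of _ g]) (auto simp: carrier_unit_series g_def left_inverse_coeff.simps intro: series_eqI)
qed (auto simp: carrier_unit_series coeff_mult mult.assoc)

interpretation unit_series: group unit_series
  by (rule group_unit_series)

abbreviation "uinv \<equiv> m_inv unit_series"

lemma uinv_mult [simp]:
  assumes "f \<in> carrier unit_series"
  shows "uinv f * f = 1" "f * uinv f = 1" "uinv f * (f * g) = g" "f * (uinv f * g) = g"
proof -
  show 1: "uinv f * f = 1" "f * uinv f = 1"
    using unit_series.l_inv[OF assms] unit_series.r_inv[OF assms] by simp_all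
  show "uinv f * (f * g) = g" "f * (uinv f * g) = g"
    by (simp_all add: 1 mult.assoc[symmetric])
qed

lemma uinv_closed [simp]: "f \<in> carrier unit_series \<Longrightarrow> uinv f \<in> carrier unit_series"
  by (rule unit_series.inv_closed)

text \<open>[u, v] - 1 = u^-1 v^-1 (u v - v u), and u v - v u equals the ring commutator of u - 1
  and v - 1. The factor in front has constant term 1, so in degree a + b only the Lie bracket of the
  parts of degrees \<open>a\<close> and \<open>b\<close> remains.\<close>

lemma commutator_unit_series:
  assumes u: "u \<in> carrier unit_series" and v: "v \<in> carrier unit_series"
    and a: "order_ge a (u - 1)" and b: "order_ge b (v - 1)"
  shows "order_ge (a + b) (commutator unit_series u v - 1)"
    and "length w = a + b \<Longrightarrow> 0 < a + b \<Longrightarrow> coeff (commutator unit_series u v) w =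
      coeff (u - 1) (take a w) * coeff (v - 1) (drop a w) -
      coeff (v - 1) (take b w) * coeff (u - 1) (drop b w)"
proof -
  define s where "s = uinv u * uinv v"
  have s: "coeff s [] = 1"
    using u v by (simp add: s_def coeff_mult flip: carrier_unit_series)
       (simp add: carrier_unit_series[THEN iffD1])
  define d where "d = (u - 1) * (v - 1) - (v - 1) * (u - 1)"
  have d: "order_ge (a + b) d"
    unfolding d_def using order_ge_mult[OF a b] order_ge_mult[OF b a]
    by (intro order_ge_diff) (simp_all add: add.commute)
  have "s * (v * u) = 1" using u v by (simp add: s_def mult.assoc)
  then have "commutator unit_series u v - 1 = s * (u * v) - s * (v * u)"
    by (simp add: commutator_def s_def)
  also have "\<dots> = s * d" by (simp add: d_def algebra_simps)
  finally have e: "commutator unit_series u v - 1 = s * d" .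
  show "order_ge (a + b) (commutator unit_series u v - 1)"
    unfolding e using order_ge_mult[OF order_ge_0 d] by simp
  assume w: "length w = a + b" "0 < a + b"
  then have "w \<noteq> []" by auto
  then have "coeff (commutator unit_series u v) w = coeff (commutator unit_series u v - 1) w" by simp
  also have "\<dots> = coeff d w"
    unfolding e using coeff_mult_order[OF order_ge_0 d, of w s] w s by simp
  also have "\<dots> = coeff (u - 1) (take a w) * coeff (v - 1) (drop a w) -
      coeff (v - 1) (take b w) * coeff (u - 1) (drop b w)"
    unfolding d_def using coeff_mult_order[OF a b w(1)] coeff_mult_order[OF b a] w(1)
    by (simp add: add.commute)
  finally show "coeff (commutator unit_series u v) w =
      coeff (u - 1) (take a w) * coeff (v - 1) (drop a w) -
      coeff (v - 1) (take b w) * coeff (u - 1) (drop b w)" .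
qed

section \<open>Leading Lie polynomials of commutator words\<close>

definition linear_part :: "'x series \<Rightarrow> 'x \<Rightarrow> int" where
  "linear_part f x = coeff f [x]"

text \<open>
  If \<open>F\<close> gives the coefficients of a homogeneous element, \<open>lie_step F \<alpha>\<close> gives those of its
  bracket with \<open>\<Sum>\<^sub>x \<alpha> x \<cdot> x\<close>.
\<close>

definition lie_step :: "('x list \<Rightarrow> int) \<Rightarrow> ('x \<Rightarrow> int) \<Rightarrow> 'x list \<Rightarrow> int" where
  "lie_step F \<alpha> w = F (butlast w) * \<alpha> (last w) - \<alpha> (hd w) * F (tl w)"

text \<open>Coefficients of the left-normed Lie bracket of the linear elements \<open>as\<close>,
  meant for words of length \<open>length as\<close>; the initial function reads the only letter of
  a one-letter word.\<close>

definition lie_coeff :: "('x \<Rightarrow> int) list \<Rightarrow> 'x list \<Rightarrow> int" where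
  "lie_coeff as = foldl lie_step (\<lambda>w. hd as (hd w)) (tl as)"

lemma lie_coeff_singleton: "lie_coeff [\<alpha>] w = \<alpha> (hd w)"
  by (simp add: lie_coeff_def)

lemma lie_coeff_snoc: "as \<noteq> [] \<Longrightarrow> lie_coeff (as @ [\<alpha>]) = lie_step (lie_coeff as) \<alpha>"
  by (simp add: lie_coeff_def)

lemma order_ge_1_unit_series: "u \<in> carrier unit_series \<Longrightarrow> order_ge 1 (u - 1)"
  by (simp add: order_ge_def carrier_unit_series)

text \<open>Induction from the right, since the last entry belongs to the outermost bracket: there
  \<open>commutator_unit_series\<close> with b = 1 becomes \<open>lie_step\<close>.\<close>

lemma left_normed_unit_series:
  assumes "us \<noteq> []" "set us \<subseteq> carrier unit_series"
  shows "order_ge (length us) (left_normed unit_series us - 1) \<and>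
    (\<forall>w. length w = length us \<longrightarrow>
      coeff (left_normed unit_series us) w = lie_coeff (map linear_part us) w)"
  using assms
proof (induction us rule: rev_induct)
  case (snoc z zs)
  show ?case
  proof (cases "zs = []")
    case True
    then show ?thesis using snoc.prems order_ge_1_unit_series[of z]
      by (auto simp: left_normed_def lie_coeff_singleton linear_part_def length_Suc_conv)
  next
    case False
    define u where "u = left_normed unit_series zs"
    have u: "u \<in> carrier unit_series" and z: "z \<in> carrier unit_series"
      using snoc.prems False by (auto simp: u_def intro!: unit_series.left_normed_closed)
    have IH: "order_ge (length zs) (u - 1)"
      "\<And>w. length w = length zs \<Longrightarrow> coeff u w = lie_coeff (map linear_part zs) w"
      using snoc.IH snoc.prems False by (auto simp: u_def)
    have e: "left_normed unit_series (zs @ [z]) = commutator unit_series u z"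
      using False by (simp add: left_normed_append u_def)
    have "coeff (commutator unit_series u z) w = lie_coeff (map linear_part (zs @ [z])) w"
      if w: "length w = length zs + 1" for w
    proof -
      have ne: "w \<noteq> []" using w by auto
      have parts: "take (length zs) w = butlast w" "drop (length zs) w = [last w]"
        "take 1 w = [hd w]" "drop 1 w = tl w"
        using w ne append_eq_conv_conj[of "butlast w" "[last w]" w] by (auto simp: take_Suc drop_Suc)
      have lens: "length (butlast w) = length zs" "length (tl w) = length zs" using w by auto
      have ne': "butlast w \<noteq> []" "tl w \<noteq> []"
        unfolding length_0_conv[symmetric] lens using False by simp_all
      have "0 < length zs + 1" by simp
      from commutator_unit_series(2)[OF u z IH(1) order_ge_1_unit_series[OF z] w this, unfolded parts]
      show ?thesis
        using ne' False by (simp add: IH(2)[OF lens(1)] IH(2)[OF lens(2)] lie_coeff_snoc lie_step_def linear_part_def)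
    qed
    then show ?thesis
      using commutator_unit_series(1)[OF u z IH(1) order_ge_1_unit_series[OF z]] by (simp add: e)
  qed
qed simp

lemma nilp_comm_word_unit_series:
  fixes c1 c2 :: nat
  assumes g: "range g \<subseteq> carrier unit_series"
  defines "F1 \<equiv> lie_coeff (map (\<lambda>i. linear_part (g i)) [1..<c1 + 2])"
    and "F2 \<equiv> lie_coeff (map (\<lambda>j. linear_part (g (c1 + 1 + j))) [1..<c2 + 2])"
  shows "order_ge (c1 + c2 + 2) (word_value unit_series g (nilp_comm_word c1 c2) - 1)"
    and "length w = c1 + c2 + 2 \<Longrightarrow> coeff (word_value unit_series g (nilp_comm_word c1 c2)) w =
      F1 (take (c1 + 1) w) * F2 (drop (c1 + 1) w) - F2 (take (c2 + 1) w) * F1 (drop (c2 + 1) w)"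
proof -
  have gc: "g i \<in> carrier unit_series" for i using g by auto
  define us vs where "us = map g [1..<c1 + 2]" and "vs = map (\<lambda>j. g (c1 + 1 + j)) [1..<c2 + 2]"
  have us: "us \<noteq> []" "set us \<subseteq> carrier unit_series" "length us = c1 + 1"
    and vs: "vs \<noteq> []" "set vs \<subseteq> carrier unit_series" "length vs = c2 + 1"
    using gc by (auto simp: us_def vs_def simp del: upt_Suc)
  have map: "map linear_part us = map (\<lambda>i. linear_part (g i)) [1..<c1 + 2]"
    "map linear_part vs = map (\<lambda>j. linear_part (g (c1 + 1 + j))) [1..<c2 + 2]"
    by (simp_all add: us_def vs_def comp_def del: upt_Suc)
  define u v where "u = left_normed unit_series us" and "v = left_normed unit_series vs"
  have u: "u \<in> carrier unit_series" and v: "v \<in> carrier unit_series"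
    unfolding u_def v_def using us vs by (simp_all add: unit_series.left_normed_closed)
  have U: "order_ge (c1 + 1) (u - 1)" "\<And>w. length w = c1 + 1 \<Longrightarrow> coeff u w = F1 w"
    using left_normed_unit_series[OF us(1,2)] by (simp_all add: u_def us(3) map F1_def del: upt_Suc)
  have V: "order_ge (c2 + 1) (v - 1)" "\<And>w. length w = c2 + 1 \<Longrightarrow> coeff v w = F2 w"
    using left_normed_unit_series[OF vs(1,2)] by (simp_all add: v_def vs(3) map F2_def del: upt_Suc)
  have e: "word_value unit_series g (nilp_comm_word c1 c2) = commutator unit_series u v"
    by (simp only: word_value_nilp_comm_word u_def v_def us_def vs_def)
  show "order_ge (c1 + c2 + 2) (word_value unit_series g (nilp_comm_word c1 c2) - 1)"
    using commutator_unit_series(1)[OF u v U(1) V(1)] by (simp add: e)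
  assume w: "length w = c1 + c2 + 2"
  then have lens: "length (take (c1 + 1) w) = c1 + 1" "length (drop (c1 + 1) w) = c2 + 1"
    "length (take (c2 + 1) w) = c2 + 1" "length (drop (c2 + 1) w) = c1 + 1"
    by simp_all
  have minus1: "coeff (x - 1) w = coeff x w" if "length w = Suc p" for x and w :: "'a list" and p
    using that by auto
  have "coeff (commutator unit_series u v) w =
      coeff (u - 1) (take (c1 + 1) w) * coeff (v - 1) (drop (c1 + 1) w) -
      coeff (v - 1) (take (c2 + 1) w) * coeff (u - 1) (drop (c2 + 1) w)"
    using w by (intro commutator_unit_series(2)[OF u v U(1) V(1)]) auto
  also have "\<dots> = coeff u (take (c1 + 1) w) * coeff v (drop (c1 + 1) w) -
      coeff v (take (c2 + 1) w) * coeff u (drop (c2 + 1) w)"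
    using lens by (simp only: minus1[of _ c1] minus1[of _ c2] Suc_eq_plus1)
  finally show "coeff (word_value unit_series g (nilp_comm_word c1 c2)) w =
      F1 (take (c1 + 1) w) * F2 (drop (c1 + 1) w) - F2 (take (c2 + 1) w) * F1 (drop (c2 + 1) w)"
    using lens by (simp only: e U(2) V(2))
qed

section \<open>Coefficients of Lie polynomials\<close>

text \<open>A coefficient at \<open>w\<close> uses the linear forms at letters of \<open>w\<close>
  only. This allows a different modulus for each word, as in
  \<open>truncation_ideal\<close>.\<close>

lemma lie_step_cong_mod:
  fixes m :: int
  assumes "list_all2 (\<lambda>\<alpha> \<beta>. \<forall>x \<in> S. \<alpha> x mod m = \<beta> x mod m) as bs"
    and "\<And>w. set w \<subseteq> S \<Longrightarrow> length w = p \<Longrightarrow> F w mod m = F' w mod m"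
    and "set w \<subseteq> S" "length w = p + length as"
  shows "foldl lie_step F as w mod m = foldl lie_step F' bs w mod m"
  using assms
proof (induction arbitrary: F F' p rule: list_all2_induct)
  case Nil
  then show ?case by simp
next
  case (Cons \<alpha> as \<beta> bs)
  have "lie_step F \<alpha> u mod m = lie_step F' \<beta> u mod m" if u: "set u \<subseteq> S" "length u = Suc p" for u
  proof -
    have "u \<noteq> []" using u by auto
    then have "last u \<in> S" "hd u \<in> S" "set (butlast u) \<subseteq> S" "set (tl u) \<subseteq> S"
      using u(1) by (auto dest: in_set_butlastD list.set_sel(2))
    then show ?thesis unfolding lie_step_def using Cons.hyps(1) Cons.prems(1) u(2)
      by (intro mod_diff_cong mod_mult_cong) auto
  qed
  then show ?case using Cons.IH[of "Suc p"] Cons.prems(2,3) by simp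
qed

lemma lie_coeff_cong_mod:
  fixes m :: int
  assumes as: "list_all2 (\<lambda>\<alpha> \<beta>. \<forall>x \<in> S. \<alpha> x mod m = \<beta> x mod m) as bs" "as \<noteq> []"
    and w: "set w \<subseteq> S" "length w = length as"
  shows "lie_coeff as w mod m = lie_coeff bs w mod m"
proof -
  obtain a as' b bs' where ab: "as = a # as'" "bs = b # bs'"
    using as by (cases as; cases bs) auto
  have "a (hd u) mod m = b (hd u) mod m" if "set u \<subseteq> S" "length u = 1" for u
    using that as(1) by (cases u) (auto simp: ab)
  then show ?thesis
    using as(1) w unfolding ab lie_coeff_def by (intro lie_step_cong_mod[where p = 1]) auto
qed

lemma linear_part_mult:
  assumes "f \<in> carrier unit_series" "g \<in> carrier unit_series"
  shows "linear_part (f * g) x = linear_part f x + linear_part g x"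
proof -
  have "linear_part (f * g) x = (\<Sum>i\<in>{0, 1}. coeff f (take i [x]) * coeff g (drop i [x]))"
    unfolding linear_part_def coeff_mult by (intro sum.cong) auto
  then show ?thesis using assms by (simp add: linear_part_def carrier_unit_series)
qed

definition letter :: "'x \<Rightarrow> 'x series" where
  "letter x = Series (\<lambda>w. if w = [] \<or> w = [x] then 1 else 0)"

lemma coeff_letter_Nil [simp]: "coeff (letter x) [] = 1"
  by (simp add: letter_def)

lemma linear_part_letter: "linear_part (letter x) = (\<lambda>y. if y = x then 1 else 0)"
  by (simp add: letter_def linear_part_def fun_eq_iff)

text \<open>In each bracketing the term that reads the first letter \<open>i\<close> vanishes by
  \<beta> i = 0, so every \<open>j\<close> is read from the right with factor 1.\<close>

lemma lie_coeff_replicate: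
  assumes "\<beta> i = 0" "\<beta> j = 1"
  shows "lie_coeff (\<alpha> # replicate p \<beta>) (i # replicate p j) = \<alpha> i"
proof (induction p)
  case (Suc p)
  have "lie_coeff (\<alpha> # replicate (Suc p) \<beta>) = lie_step (lie_coeff (\<alpha> # replicate p \<beta>)) \<beta>"
    using lie_coeff_snoc[of "\<alpha> # replicate p \<beta>" \<beta>] by (simp add: replicate_append_same)
  moreover have "i # replicate (Suc p) j = (i # replicate p j) @ [j]"
    by (simp add: replicate_append_same)
  ultimately show ?case using Suc assms by (simp add: lie_step_def del: replicate_Suc)
qed (simp add: lie_coeff_singleton)

text \<open>On a power of one letter the two terms of the outermost bracket cancel.\<close>

lemma lie_coeff_replicate_same:
  "lie_coeff (\<alpha> # replicate (Suc p) \<beta>) (replicate (Suc (Suc p)) j) = 0"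
proof -
  have "lie_coeff (\<alpha> # replicate (Suc p) \<beta>) = lie_step (lie_coeff (\<alpha> # replicate p \<beta>)) \<beta>"
    using lie_coeff_snoc[of "\<alpha> # replicate p \<beta>" \<beta>] by (simp add: replicate_append_same)
  moreover have "butlast (replicate (Suc (Suc p)) j) = replicate (Suc p) j"
    "last (replicate (Suc (Suc p)) j) = j" "tl (replicate (Suc (Suc p)) j) = replicate (Suc p) j"
    by (simp_all add: butlast_conv_take flip: replicate_Suc)
  ultimately show ?thesis by (simp add: lie_step_def del: replicate_Suc)
qed

text \<open>
  For \<open>c\<^sub>2 < c\<^sub>1\<close> take \<open>[[h, e\<^sub>j, \<dots>, e\<^sub>j], [e\<^sub>i, e\<^sub>j, \<dots>, e\<^sub>j]]\<close>; for \<open>c\<^sub>1 = c\<^sub>2\<close> replace the last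
  entry of the first bracket by \<open>e\<^sub>i\<close>, which makes the two brackets independent.
\<close>

lemma nilp_comm_word_detects:
  fixes i j :: 'x
  assumes c: "c2 < c1 \<and> 1 \<le> c2 \<or> c1 = c2 \<and> 1 < c1" and ij: "i \<noteq> j"
  obtains g w \<epsilon> where "range g \<subseteq> carrier unit_series" "g 1 = 1" "length w = c1 + c2 + 2"
    "set w = {i, j}" "\<epsilon> \<in> {1, -1}"
    "\<And>h. h \<in> carrier unit_series \<Longrightarrow>
      coeff (word_value unit_series (g(1 := h)) (nilp_comm_word c1 c2)) w = \<epsilon> * linear_part h i"
proof -
  define ei ej :: "'x \<Rightarrow> int" where "ei = linear_part (letter i)" and "ej = linear_part (letter j)"
  have e: "ei i = 1" "ei j = 0" "ej i = 0" "ej j = 1"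
    using ij by (auto simp: ei_def ej_def linear_part_letter)
  from c show thesis
  proof
    assume c: "c2 < c1 \<and> 1 \<le> c2"
    define g :: "nat \<Rightarrow> 'x series" where
      "g p = (if p = 1 then 1 else if p = c1 + 2 then letter i else letter j)" for p
    \<comment> \<open>Cutting after c1 + 1 > c2 + 1 letters leaves only letters \<open>j\<close> on
      the right, where the second bracket vanishes. Cutting after c2 + 1 letters separates the two
      blocks, each of which starts with \<open>i\<close>.\<close>
    define w where "w = i # replicate c2 j @ i # replicate c1 j"
    have g: "range (g(1 := h)) \<subseteq> carrier unit_series" if "h \<in> carrier unit_series" for h
      using that by (auto simp: g_def carrier_unit_series)
    have val: "coeff (word_value unit_series (g(1 := h)) (nilp_comm_word c1 c2)) w = - 1 * linear_part h i"
      if h: "h \<in> carrier unit_series" for h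
    proof -
      have 1: "map (\<lambda>p. linear_part ((g(1 := h)) p)) [1..<c1 + 2] = linear_part h # replicate c1 ej"
        by (intro nth_equalityI) (auto simp: g_def ej_def nth_Cons' simp del: upt_Suc)
      have 2: "map (\<lambda>p. linear_part ((g(1 := h)) (c1 + 1 + p))) [1..<c2 + 2] = ei # replicate c2 ej"
        by (intro nth_equalityI) (auto simp: g_def ei_def ej_def nth_Cons' simp del: upt_Suc)
      have d1: "drop (c1 + 1) w = replicate (Suc c2) j"
        using c by (simp add: w_def drop_Cons' Suc_diff_le del: replicate_Suc)
      have t2: "take (c2 + 1) w = i # replicate c2 j" and d2: "drop (c2 + 1) w = i # replicate c1 j"
        by (simp_all add: w_def)
      have z: "lie_coeff (ei # replicate c2 ej) (replicate (Suc c2) j) = 0"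
        using lie_coeff_replicate_same[of ei "c2 - 1" ej j] c by simp
      have lw: "length w = c1 + c2 + 2" by (simp add: w_def)
      show ?thesis
        unfolding nilp_comm_word_unit_series(2)[OF g[OF h] lw] 1 2 d1 t2 d2 z
        by (simp add: lie_coeff_replicate e)
    qed
    show thesis
      using g[of 1] c by (intro that[OF _ _ _ _ _ val]) (auto simp: w_def g_def carrier_unit_series)
  next
    assume c: "c1 = c2 \<and> 1 < c1"
    obtain p where p: "c1 = Suc (Suc p)" "c2 = Suc (Suc p)"
      using c by (intro that[of "c1 - 2"]) auto
    \<comment> \<open>Variable c1 + 1 is the last entry of the first bracket and variable c1 + 2 is
      y_1.\<close>
    define g :: "nat \<Rightarrow> 'x series" where
      "g q = (if q = 1 then 1 else if q = c1 + 1 \<or> q = c1 + 2 then letter i else letter j)" for q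
    \<comment> \<open>Both terms cut \<open>w\<close> in the middle. On the left half the first
      bracket has coefficient 0 and the second has 1; on the right half the first has minus the
      coefficient of \<open>i\<close> in \<open>h\<close>.\<close>
    define w where "w = (i # replicate c1 j) @ i # i # replicate (Suc p) j"
    have g: "range (g(1 := h)) \<subseteq> carrier unit_series" if "h \<in> carrier unit_series" for h
      using that by (auto simp: g_def carrier_unit_series)
    have val: "coeff (word_value unit_series (g(1 := h)) (nilp_comm_word c1 c2)) w = 1 * linear_part h i"
      if h: "h \<in> carrier unit_series" for h
    proof -
      define \<alpha> where "\<alpha> = linear_part h"
      have 1: "map (\<lambda>p. linear_part ((g(1 := h)) p)) [1..<c1 + 2] = (\<alpha> # replicate (Suc p) ej) @ [ei]"
        by (intro nth_equalityI)
          (auto simp: g_def \<alpha>_def ei_def ej_def nth_Cons' nth_append p simp del: upt_Suc)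
      have 2: "map (\<lambda>p. linear_part ((g(1 := h)) (c1 + 1 + p))) [1..<c2 + 2] = ei # replicate c2 ej"
        by (intro nth_equalityI) (auto simp: g_def ei_def ej_def nth_Cons' p simp del: upt_Suc)
      have parts: "take (c1 + 1) w = i # replicate c2 j" "take (c2 + 1) w = i # replicate c2 j"
        "drop (c2 + 1) w = i # i # replicate (Suc p) j"
        by (simp_all add: w_def p)
      have lw: "length w = c1 + c2 + 2" by (simp add: w_def p)
      have bl: "butlast (i # replicate c2 j) = i # replicate (Suc p) j" "last (i # replicate c2 j) = j"
        "last (i # i # replicate (Suc p) j) = j"
        by (simp_all add: p butlast_conv_take flip: replicate_Suc)
      have s: "lie_coeff ((\<alpha> # replicate (Suc p) ej) @ [ei]) u =
          lie_coeff (\<alpha> # replicate (Suc p) ej) (butlast u) * ei (last u) -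
          ei (hd u) * lie_coeff (\<alpha> # replicate (Suc p) ej) (tl u)" for u
        by (subst lie_coeff_snoc) (simp_all add: lie_step_def)
      have L1: "lie_coeff ((\<alpha> # replicate (Suc p) ej) @ [ei]) (i # replicate c2 j) = 0"
        unfolding s bl e list.sel using lie_coeff_replicate_same[of \<alpha> p ej j] by (simp add: p)
      have L2: "lie_coeff ((\<alpha> # replicate (Suc p) ej) @ [ei]) (i # i # replicate (Suc p) j) = - \<alpha> i"
        using lie_coeff_replicate[of ej i j \<alpha> "Suc p"] by (simp only: s bl e list.sel)
      show ?thesis
        unfolding nilp_comm_word_unit_series(2)[OF g[OF h] lw] 1 2 parts L1 L2
        by (simp add: lie_coeff_replicate e \<alpha>_def)
    qed
    show thesis
      using g[of 1] c by (intro that[OF _ _ _ _ _ val]) (auto simp: w_def g_def carrier_unit_series p)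
  qed
qed

section \<open>Rank at least two is sufficient\<close>

text \<open>\<open>\<nu> x\<close> is the order of the generator \<open>x\<close> of the quotient to be realized, or \<open>0\<close> if it is infinite.\<close>

definition truncation_ideal :: "('x \<Rightarrow> int) \<Rightarrow> 'x set \<Rightarrow> nat \<Rightarrow> 'x series set" where
  "truncation_ideal \<nu> S N = {f. \<forall>w. set w \<subseteq> S \<longrightarrow>
     (length w < N \<longrightarrow> coeff f w = 0) \<and> (length w = N \<longrightarrow> Gcd (\<nu> ` set w) dvd coeff f w)}"

lemma truncation_ideal_add:
  "f \<in> truncation_ideal \<nu> S N \<Longrightarrow> g \<in> truncation_ideal \<nu> S N \<Longrightarrow> f + g \<in> truncation_ideal \<nu> S N"
  by (simp add: truncation_ideal_def)

text \<open>At a word of length \<open>N\<close>, a proper prefix contributes 0 because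
  \<open>f\<close> vanishes below degree \<open>N\<close>, and the remaining cut takes the
  coefficient of \<open>f\<close> at the same word, hence with the same gcd.\<close>

lemma truncation_ideal_mult_right:
  assumes "f \<in> truncation_ideal \<nu> S N"
  shows "f * g \<in> truncation_ideal \<nu> S N"
proof -
  have 1: "coeff f (take i w) = 0" if "set w \<subseteq> S" "length w \<le> N" "i \<le> length w" "i < N" for w i
    using assms that set_take_subset[of i w] by (auto simp: truncation_ideal_def)
  have 2: "Gcd (\<nu> ` set w) dvd coeff (f * g) w" if w: "set w \<subseteq> S" "length w = N" for w
    unfolding coeff_mult
  proof (intro dvd_sum)
    fix i assume "i \<in> {..length w}"
    then consider "i < N" | "take i w = w" using w by fastforce
    then show "Gcd (\<nu> ` set w) dvd coeff f (take i w) * coeff g (drop i w)"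
    proof cases
      case 1
      then show ?thesis using \<open>i \<in> _\<close> w 1 assms set_take_subset[of i w]
        by (auto simp: truncation_ideal_def)
    next
      case 2
      then show ?thesis using assms w by (simp add: truncation_ideal_def)
    qed
  qed
  show ?thesis unfolding truncation_ideal_def using 1 2 by (auto simp: coeff_mult intro!: sum.neutral)
qed

lemma truncation_ideal_mult_left:
  assumes "f \<in> truncation_ideal \<nu> S N"
  shows "g * f \<in> truncation_ideal \<nu> S N"
proof -
  have 1: "coeff f (drop i w) = 0" if "set w \<subseteq> S" "length w \<le> N" "length w - i < N" for w i
    using assms that set_drop_subset[of i w] by (auto simp: truncation_ideal_def)
  have 2: "Gcd (\<nu> ` set w) dvd coeff (g * f) w" if w: "set w \<subseteq> S" "length w = N" for w
    unfolding coeff_mult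
  proof (intro dvd_sum)
    fix i assume "i \<in> {..length w}"
    then consider "length w - i < N" | "drop i w = w" using w by (cases i) auto
    then show "Gcd (\<nu> ` set w) dvd coeff g (take i w) * coeff f (drop i w)"
    proof cases
      case 1
      then show ?thesis using w assms set_drop_subset[of i w]
        by (auto simp: truncation_ideal_def)
    next
      case 2
      then show ?thesis using assms w by (simp add: truncation_ideal_def)
    qed
  qed
  show ?thesis unfolding truncation_ideal_def using 1 2 by (auto simp: coeff_mult intro!: sum.neutral)
qed

text \<open>The congruence subgroup of a two-sided ideal: products, inverses and conjugates change f
  - 1 by ring operations under which the ideal is stable.\<close>

lemma truncation_subgroup_normal:
  fixes \<nu> :: "'x \<Rightarrow> int"
  assumes "0 < N"
  shows "{f \<in> carrier unit_series. f - 1 \<in> truncation_ideal \<nu> S N} \<lhd> unit_series" (is "?K \<lhd> _")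
proof (rule unit_series.normal_invI)
  show "subgroup ?K unit_series"
  proof (rule unit_series.subgroupI)
    have "1 \<in> ?K" by (simp add: carrier_unit_series truncation_ideal_def)
    then show "?K \<noteq> {}" by blast
  next
    fix f assume f: "f \<in> ?K"
    have e: "uinv f - 1 = - uinv f * (f - 1)" using f by (simp add: algebra_simps)
    have "uinv f - 1 \<in> truncation_ideal \<nu> S N"
      unfolding e using f by (intro truncation_ideal_mult_left) auto
    then show "uinv f \<in> ?K" using f by simp
  next
    fix f g assume f: "f \<in> ?K" and g: "g \<in> ?K"
    have e: "f * g - 1 = (f - 1) * g + (g - 1)" by (simp add: algebra_simps)
    have "f * g - 1 \<in> truncation_ideal \<nu> S N"
      unfolding e using f g by (intro truncation_ideal_add truncation_ideal_mult_right) auto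
    then show "f \<otimes>\<^bsub>unit_series\<^esub> g \<in> ?K"
      using f g unit_series.m_closed[of f g] by simp
  qed auto
next
  fix h f :: "'x series" assume h: "h \<in> carrier unit_series" and f: "f \<in> ?K"
  have e: "h * f * uinv h - 1 = h * (f - 1) * uinv h" using h by (simp add: algebra_simps)
  have "h * f * uinv h - 1 \<in> truncation_ideal \<nu> S N"
    unfolding e using f by (intro truncation_ideal_mult_right truncation_ideal_mult_left) auto
  then show "h \<otimes>\<^bsub>unit_series\<^esub> f \<otimes>\<^bsub>unit_series\<^esub> uinv h \<in> ?K"
    using f h unit_series.m_closed[of "h \<otimes>\<^bsub>unit_series\<^esub> f" "uinv h"] unit_series.m_closed[of h f] by simp
qed

text \<open>A canonical representative modulo \<open>truncation_ideal\<close>. If the gcd is 0,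
  reduction leaves the integer coefficient as it is.\<close>

definition truncate :: "('x \<Rightarrow> int) \<Rightarrow> 'x set \<Rightarrow> nat \<Rightarrow> 'x series \<Rightarrow> 'x list \<Rightarrow> int" where
  "truncate \<nu> S N f = (\<lambda>w\<in>{w. set w \<subseteq> S \<and> length w \<le> N}.
     if length w < N then coeff f w else coeff f w mod Gcd (\<nu> ` set w))"

lemma truncate_eq_iff: "truncate \<nu> S N f = truncate \<nu> S N g \<longleftrightarrow> f - g \<in> truncation_ideal \<nu> S N"
proof -
  have "truncate \<nu> S N f = truncate \<nu> S N g \<longleftrightarrow> (\<forall>w. set w \<subseteq> S \<and> length w \<le> N \<longrightarrow>
      truncate \<nu> S N f w = truncate \<nu> S N g w)"
    by (auto simp: fun_eq_iff truncate_def)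
  also have "\<dots> \<longleftrightarrow> f - g \<in> truncation_ideal \<nu> S N"
    unfolding truncation_ideal_def
    by (auto simp: truncate_def mod_eq_dvd_iff le_less split: if_splits)
  finally show ?thesis .
qed

lemma weak_group_morphism_truncate:
  fixes \<nu> :: "'x \<Rightarrow> int"
  assumes "0 < N"
  shows "weak_group_morphism (truncate \<nu> S N)
    {f \<in> carrier unit_series. f - 1 \<in> truncation_ideal \<nu> S N} unit_series"
proof (intro weak_group_morphism.intro weak_group_morphism_axioms.intro truncation_subgroup_normal assms)
  fix a b :: "'x series" assume a: "a \<in> carrier unit_series" and b: "b \<in> carrier unit_series"
  have "a - b = (a * uinv b - 1) * b" "a * uinv b - 1 = (a - b) * uinv b"
    using b by (simp_all add: algebra_simps)
  then have "a - b \<in> truncation_ideal \<nu> S N \<longleftrightarrow> a * uinv b - 1 \<in> truncation_ideal \<nu> S N"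
    by (metis truncation_ideal_mult_right)
  then show "truncate \<nu> S N a = truncate \<nu> S N b \<longleftrightarrow>
      a \<otimes>\<^bsub>unit_series\<^esub> uinv b \<in> {f \<in> carrier unit_series. f - 1 \<in> truncation_ideal \<nu> S N}"
    using a b unit_series.m_closed[of a "uinv b"] by (simp add: truncate_eq_iff)
qed

text \<open>Over finitely many letters there are finitely many words of length at most
  \<open>N\<close>, so a truncation amounts to a finite list of integers.\<close>

lemma countable_range_truncate:
  assumes "finite S"
  shows "countable (range (truncate \<nu> S N))"
proof -
  obtain ws where ws: "set ws = {w. set w \<subseteq> S \<and> length w \<le> N}"
    using finite_list[OF finite_lists_length_le[OF assms]] by blast
  have "inj_on (\<lambda>F. map F ws) (range (truncate \<nu> S N))"
  proof (rule inj_onI)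
    fix F F' assume "F \<in> range (truncate \<nu> S N)" "F' \<in> range (truncate \<nu> S N)"
    then have "F \<in> extensional (set ws)" "F' \<in> extensional (set ws)"
      unfolding ws by (auto simp: truncate_def)
    moreover assume "map F ws = map F' ws"
    ultimately show "F = F'" by (intro extensionalityI) auto
  qed
  then show ?thesis by (rule countable_image_inj_on[OF countableI_type])
qed

text \<open>Only linear parts of the entries enter in degree c1 + c2 + 2; if each \<nu> x divides
  the linear part of \<open>h\<close> at x, a shift by \<open>h\<close> preserves them modulo the
  gcd at each word. Conversely, \<open>free\<close> gives a partner \<open>j\<close> of infinite
  order for each \<open>i\<close>, and \<open>nilp_comm_word_detects\<close> then reads off the
  linear part at \<open>i\<close> modulo \<nu> i.\<close>

lemma marginal_mod_truncation_iff:
  fixes \<nu> :: "'x \<Rightarrow> int"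
  assumes c: "c2 < c1 \<and> 1 \<le> c2 \<or> c1 = c2 \<and> 1 < c1"
    and free: "\<And>i. i \<in> S \<Longrightarrow> \<exists>j \<in> S. j \<noteq> i \<and> \<nu> j = 0"
    and h: "h \<in> carrier unit_series"
  shows "(\<forall>x \<in> S. \<nu> x dvd linear_part h x) \<longleftrightarrow>
    (\<forall>g. range g \<subseteq> carrier unit_series \<longrightarrow> (\<forall>i.
      truncate \<nu> S (c1 + c2 + 2) (word_value unit_series (g(i := g i \<otimes>\<^bsub>unit_series\<^esub> h)) (nilp_comm_word c1 c2)) =
      truncate \<nu> S (c1 + c2 + 2) (word_value unit_series g (nilp_comm_word c1 c2))))"
    (is "?L \<longleftrightarrow> ?R")
proof
  assume L: ?L
  show ?R
  proof (intro allI impI)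
    fix g :: "nat \<Rightarrow> 'x series" and i assume g: "range g \<subseteq> carrier unit_series"
    define g' where "g' = g(i := g i \<otimes>\<^bsub>unit_series\<^esub> h)"
    have gc: "g p \<in> carrier unit_series" for p using g by auto
    have g': "range g' \<subseteq> carrier unit_series"
      using gc h unit_series.m_closed[of "g i" h] by (auto simp: g'_def)
    let ?N = "c1 + c2 + 2" and ?W = "\<lambda>g. word_value unit_series g (nilp_comm_word c1 c2)"
    have "?W g' - ?W g \<in> truncation_ideal \<nu> S ?N"
      unfolding truncation_ideal_def
    proof (intro CollectI allI impI conjI)
      fix w :: "'x list" assume w: "set w \<subseteq> S" "length w < ?N"
      then have "coeff ((?W g' - 1) - (?W g - 1)) w = 0"
        using nilp_comm_word_unit_series(1)[OF g] nilp_comm_word_unit_series(1)[OF g']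
        unfolding order_ge_def coeff_simps(5) by (metis diff_self)
      then show "coeff (?W g' - ?W g) w = 0" by simp
    next
      fix w :: "'x list" assume w: "set w \<subseteq> S" "length w = ?N"
      define m where "m = Gcd (\<nu> ` set w)"
      have lin: "linear_part (g' p) x mod m = linear_part (g p) x mod m" if "x \<in> set w" for p x
      proof -
        have "m dvd \<nu> x" unfolding m_def using that by (intro Gcd_dvd) auto
        also have "\<nu> x dvd linear_part h x" using L w(1) that by blast
        finally have "m dvd linear_part h x" .
        then show ?thesis
          using linear_part_mult[OF gc h, of i x] by (auto simp: g'_def mod_eq_dvd_iff)
      qed
      have lie: "lie_coeff (map (\<lambda>p. linear_part (g' (\<sigma> p))) [1..<c + 2]) u mod m =
          lie_coeff (map (\<lambda>p. linear_part (g (\<sigma> p))) [1..<c + 2]) u mod m"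
        if "set u \<subseteq> set w" "length u = c + 1" for c u and \<sigma> :: "nat \<Rightarrow> nat"
        using that lin by (intro lie_coeff_cong_mod[where S = "set w"])
          (auto simp: list_all2_map1 list_all2_map2 list_all2_same simp del: upt_Suc)
      have "coeff (?W g') w mod m = coeff (?W g) w mod m"
        unfolding nilp_comm_word_unit_series(2)[OF g w(2)] nilp_comm_word_unit_series(2)[OF g' w(2)]
        by (intro mod_diff_cong mod_mult_cong lie)
          (use w(2) set_take_subset[of _ w] set_drop_subset[of _ w] in auto)
      then show "Gcd (\<nu> ` set w) dvd coeff (?W g' - ?W g) w"
        by (simp add: mod_eq_dvd_iff m_def)
    qed
    then show "truncate \<nu> S ?N (?W (g(i := g i \<otimes>\<^bsub>unit_series\<^esub> h))) = truncate \<nu> S ?N (?W g)"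
      by (simp only: truncate_eq_iff g'_def)
  qed
next
  assume R: ?R
  show ?L
  proof
    fix i assume i: "i \<in> S"
    then obtain j where j: "j \<in> S" "j \<noteq> i" "\<nu> j = 0" using free by blast
    obtain g w \<epsilon> where g: "range g \<subseteq> carrier unit_series" "g 1 = 1"
      and w: "length w = c1 + c2 + 2" "set w = {i, j}" and \<epsilon>: "\<epsilon> \<in> {1, -1}" and
      val: "\<And>h. h \<in> carrier unit_series \<Longrightarrow>
        coeff (word_value unit_series (g(1 := h)) (nilp_comm_word c1 c2)) w = \<epsilon> * linear_part h i"
      using nilp_comm_word_detects[OF c, of i j] j(2) by metis
    have gg: "g(1 := g 1 \<otimes>\<^bsub>unit_series\<^esub> h) = g(1 := h)" "g = g(1 := 1)"
      using g(2) by auto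
    let ?W = "\<lambda>g. word_value unit_series g (nilp_comm_word c1 c2)"
    have "?W (g(1 := g 1 \<otimes>\<^bsub>unit_series\<^esub> h)) - ?W g \<in> truncation_ideal \<nu> S (c1 + c2 + 2)"
      using R g(1) truncate_eq_iff by blast
    then have "?W (g(1 := h)) - ?W g \<in> truncation_ideal \<nu> S (c1 + c2 + 2)"
      by (simp only: gg(1))
    moreover have "set w \<subseteq> S" using w(2) i j(1) by simp
    ultimately have "Gcd (\<nu> ` set w) dvd coeff (?W (g(1 := h)) - ?W g) w"
      using w(1) unfolding truncation_ideal_def by blast
    moreover have "coeff (?W g) w = 0"
      using val[of 1] unfolding gg(2)[symmetric] by (simp add: carrier_unit_series linear_part_def)
    ultimately have "Gcd (\<nu> ` set w) dvd \<epsilon> * linear_part h i" using val[OF h] by simp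
    \<comment> \<open>As \<nu> j = 0, the gcd over the letters of \<open>w\<close> is \<nu> i up to
      sign, and \<epsilon> is a unit.\<close>
    then show "\<nu> i dvd linear_part h i" using w(2) j(3) \<epsilon> by auto
  qed
qed

lemma restrict_eq_iff: "restrict f A = restrict g A \<longleftrightarrow> (\<forall>x \<in> A. f x = g x)"
  by (metis restrict_apply' restrict_ext)

text \<open>Letters 1 to k stand for the infinite cyclic summands and k + 1 to k + t for the finite
  ones. The map \<open>\<phi>\<close> reduces the linear part of a series modulo the orders, and
  \<open>marginal_mod_truncation_iff\<close> identifies its kernel.\<close>

lemma fg_abelian_sum_capable:
  assumes "infinite (UNIV :: 'e set)"
    and c: "c2 < c1 \<and> 1 \<le> c2 \<or> c1 = c2 \<and> 1 < c1"
    and n: "\<And>i. 1 \<le> i \<Longrightarrow> i \<le> t \<Longrightarrow> n i > 0"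
    and k: "k \<ge> 2"
  shows "variety_capable TYPE('e) {nilp_comm_word c1 c2} (fg_abelian_sum k t n)"
proof -
  define S where "S = {1..k + t}"
  define \<nu> where "\<nu> x = (if x \<le> k then 0 else int (n (x - k)))" for x
  define \<phi> :: "nat series \<Rightarrow> _" where "\<phi> f = (\<lambda>i\<in>{1..k}. linear_part f i,
    \<lambda>i\<in>{1..t}. linear_part f (k + i) mod int (n i))" for f
  \<comment> \<open>Rank at least two enters here: of the letters 1 and 2, both of infinite order,
    one differs from \<open>i\<close>.\<close>
  have free: "\<exists>j \<in> S. j \<noteq> i \<and> \<nu> j = 0" for i
    using k by (intro bexI[of _ "if i = 1 then 2 else 1"]) (auto simp: S_def \<nu>_def)
  have hom: "group_hom unit_series (fg_abelian_sum k t n) \<phi>"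
  proof (intro group_hom.intro group_hom_axioms.intro group_unit_series group_fg_abelian_sum homI)
    show "\<phi> f \<in> carrier (fg_abelian_sum k t n)" for f
      using n by (auto simp: carrier_fg_abelian_sum \<phi>_def)
    show "\<phi> (f \<otimes>\<^bsub>unit_series\<^esub> g) = \<phi> f \<otimes>\<^bsub>fg_abelian_sum k t n\<^esub> \<phi> g"
      if "f \<in> carrier unit_series" "g \<in> carrier unit_series" for f g
      using that by (auto simp: \<phi>_def mult_fg_abelian_sum linear_part_mult fun_eq_iff mod_add_eq)
  qed
  have surj: "\<phi> ` carrier unit_series = carrier (fg_abelian_sum k t n)"
  proof
    show "\<phi> ` carrier unit_series \<subseteq> carrier (fg_abelian_sum k t n)"
      using hom by (auto simp: group_hom.hom_closed)
    show "carrier (fg_abelian_sum k t n) \<subseteq> \<phi> ` carrier unit_series"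
    proof
      fix y assume y: "y \<in> carrier (fg_abelian_sum k t n)"
      \<comment> \<open>Only one-letter words matter for \<open>\<phi>\<close>; longer words just
        repeat the value at their first letter.\<close>
      define f where "f = Series (\<lambda>w. if w = [] then 1
        else if hd w \<le> k then fst y (hd w) else snd y (hd w - k))"
      have 1: "fst y \<in> (\<Pi>\<^sub>E i\<in>{1..k}. UNIV)" and 2: "snd y \<in> (\<Pi>\<^sub>E i\<in>{1..t}. {0..<int (n i)})"
        using y n by (auto simp: carrier_fg_abelian_sum)
      have "(\<lambda>i\<in>{1..k}. linear_part f i) = restrict (fst y) {1..k}"
        by (intro restrict_ext) (auto simp: f_def linear_part_def)
      moreover have "(\<lambda>i\<in>{1..t}. linear_part f (k + i) mod int (n i)) = restrict (snd y) {1..t}"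
        using PiE_mem[OF 2] by (intro restrict_ext) (auto simp: f_def linear_part_def)
      ultimately have "\<phi> f = y"
        using PiE_restrict[OF 1] PiE_restrict[OF 2] by (simp add: \<phi>_def)
      moreover have "f \<in> carrier unit_series" by (simp add: f_def carrier_unit_series)
      ultimately show "y \<in> \<phi> ` carrier unit_series" by blast
    qed
  qed
  have ker: "\<phi> h = \<one>\<^bsub>fg_abelian_sum k t n\<^esub> \<longleftrightarrow> (\<forall>x \<in> S. \<nu> x dvd linear_part h x)" for h
  proof -
    have "\<phi> h = \<one>\<^bsub>fg_abelian_sum k t n\<^esub> \<longleftrightarrow>
        (\<forall>i \<in> {1..k}. linear_part h i = 0) \<and> (\<forall>i \<in> {1..t}. int (n i) dvd linear_part h (k + i))"
      by (simp add: \<phi>_def one_fg_abelian_sum restrict_eq_iff dvd_eq_mod_eq_0)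
    also have "\<dots> \<longleftrightarrow> (\<forall>x \<in> S. \<nu> x dvd linear_part h x)"
    proof (intro iffI ballI conjI)
      fix x assume *: "(\<forall>i \<in> {1..k}. linear_part h i = 0) \<and>
        (\<forall>i \<in> {1..t}. int (n i) dvd linear_part h (k + i))" and x: "x \<in> S"
      show "\<nu> x dvd linear_part h x"
      proof (cases "x \<le> k")
        case False
        then have "x - k \<in> {1..t}" "k + (x - k) = x" using x by (auto simp: S_def)
        then show ?thesis using * False unfolding \<nu>_def by metis
      qed (use * x in \<open>auto simp: \<nu>_def S_def\<close>)
    next
      assume *: "\<forall>x \<in> S. \<nu> x dvd linear_part h x"
      show "linear_part h i = 0" if "i \<in> {1..k}" for i
        using *[rule_format, of i] that by (auto simp: \<nu>_def S_def)
      show "int (n i) dvd linear_part h (k + i)" if "i \<in> {1..t}" for i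
        using *[rule_format, of "k + i"] that by (auto simp: \<nu>_def S_def)
    qed
    finally show ?thesis .
  qed
  have N: "0 < c1 + c2 + 2" and S: "finite S" by (simp_all add: S_def)
  show ?thesis
  proof (rule variety_capableI[OF assms(1) weak_group_morphism_truncate[OF N, of \<nu> S] _ hom surj])
    show "countable (truncate \<nu> S (c1 + c2 + 2) ` carrier unit_series)"
      using countable_range_truncate[OF S] by (rule countable_subset[rotated]) auto
  next
    fix h :: "nat series" assume "h \<in> carrier unit_series"
    then show "\<phi> h = \<one>\<^bsub>fg_abelian_sum k t n\<^esub> \<longleftrightarrow> (\<forall>v \<in> {nilp_comm_word c1 c2}. \<forall>g.
      range g \<subseteq> carrier unit_series \<longrightarrow> (\<forall>i.
        truncate \<nu> S (c1 + c2 + 2) (word_value unit_series (g(i := g i \<otimes>\<^bsub>unit_series\<^esub> h)) v) =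
        truncate \<nu> S (c1 + c2 + 2) (word_value unit_series g v)))"
      unfolding ker using marginal_mod_truncation_iff[OF c free, of h] by simp
  qed
qed

theorem theorem3p5:
  fixes c1 c2 k t :: nat and n :: "nat \<Rightarrow> nat" and G :: "('a, 'b) monoid_scheme"
  assumes "infinite (UNIV :: 'e set)"
    and "c1 \<ge> 1" and "c2 \<ge> 1"
    and "(c2 < c1 \<and> c1 \<le> 2 * c2) \<or> (c1 = c2 \<and> c1 > 1)"
    and "\<And>i. 1 \<le> i \<Longrightarrow> i \<le> t \<Longrightarrow> n i > 0"
    and "\<And>i. 1 \<le> i \<Longrightarrow> i + 1 \<le> t \<Longrightarrow> n (i + 1) dvd n i"
    and "comm_group G" and "infinite (carrier G)"
    and "G \<cong> fg_abelian_sum k t n"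
  shows "variety_capable TYPE('e) {nilp_comm_word c1 c2} G \<longleftrightarrow> k \<ge> 2"
proof
  assume "variety_capable TYPE('e) {nilp_comm_word c1 c2} G"
  then show "k \<ge> 2"
    using assms by (elim capable_imp_rank_ge_2) auto
next
  assume "k \<ge> 2"
  moreover have "c2 < c1 \<and> 1 \<le> c2 \<or> c1 = c2 \<and> 1 < c1" using assms(3,4) by auto
  ultimately have "variety_capable TYPE('e) {nilp_comm_word c1 c2} (fg_abelian_sum k t n)"
    using assms(1,5) by (intro fg_abelian_sum_capable) auto
  then show "variety_capable TYPE('e) {nilp_comm_word c1 c2} G"
    unfolding variety_capable_def using iso_trans[OF assms(9)] by blast
qed

end
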